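(* Let $q$ be a prime power, $\epsilon\in[0,1)$, $t_0^s\in\mathbb{R}$, and let $n\ge k\ge2$ be integers. Let $\mathcal{C}$ be a random $(n,k)$-coding scheme over $q\mathrm{EC}(\epsilon)$, and let $\Delta^{lin}_\epsilon$ be the optimal average age among linear block codes over $q\mathrm{EC}(\epsilon)$. Then almost surely $$\Delta^{lb}_{\epsilon,(n,k)}\le\Delta_{\epsilon,\mathcal{C}}\le\Delta^{ub}_{\epsilon,(n,k)},$$ and $$\Delta_{\epsilon,\mathcal{C}}\ \ge\ \Delta^{lin}_\epsilon\ \ge\ \min_{n'\ge k}\Delta^{lb}_{\epsilon,(n',k)},$$ where, with $p_{k-1}=(1-\epsilon)\frac{q^{k-1}(q-1)}{q^k-1}$ and $[x]=x-\lfloor x\rfloor$, $$\Delta^{ub}_{\epsilon,(n,k)}=\frac{2np_{k-1}-p_{k-1}(n+2)\mathbb{P}(\hat B\le n)+2k\,\mathbb{P}(\hat{\hat B}\le n+1)}{2p_{k-1}\mathbb{P}(\hat B\le n)}+[-t_0^s],$$ $$\Delta^{lb}_{\epsilon,(n,k)}=\frac{2n(1-\epsilon)-(1-\epsilon)(n+2)\mathbb{P}(\tilde B\le n)+2k\,\mathbb{P}(\tilde{\tilde B}\le n+1)}{2(1-\epsilon)\mathbb{P}(\tilde B\le n)}+[-t_0^s].$$ Here $\tilde B$ and $\tilde{\tilde B}$ are sums of $k$, respectively $k+1$, i.i.d. geometric random variables on $\{1,2,\dots\}$ with success probability $1-\epsilon$, and $\hat B$ and $\hat{\hat B}$ are sums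 of $k$, respectively $k+1$, i.i.d. geometric random variables on $\{1,2,\dots\}$ with success probability $p_{k-1}$.
   Context: Setting: $q\mathrm{EC}(\epsilon)$ is the memoryless erasure channel with input alphabet $\mathbb{F}_q$: each input is independently erased with probability $\epsilon$ and otherwise received unchanged and instantaneously. The $i$-th channel use ($i\ge1$) takes place at time $i$. The source message $U_m\in\mathbb{F}_q^k$ is generated at time $m+t_0^s$ (indices $m\in\mathbb{Z}$). $(n,k)$-scheme induced by linear encoders $F_l(u)=u^T\mathbf{G}_l$, $\mathbf{G}_l\in\mathbb{F}_q^{k\times n}$, $l\ge1$: the $l$-th transmitted message is $U_{m(l)}$ with $m(l)=\lfloor (l-1)n+1-t_0^s\rfloor$; the $n$ coordinates of $F_l(U_{m(l)})$ are sent in order at channel uses $(l-1)n+1,\dots,ln$. All other source messages are discarded. The $l$-th transmitted message is decoded at the first channel use of its block (if any) at which it is uniquely determined by the non-erased symbols of the block received so far (i.e. the corresponding columns of $\mathbf{G}_l$ span $\mathbb{F}_q^k$); otherwise it is lost. Random $(n,k)$-scheme: all columns of all $\mathbf{G}_l$ are independent and uniform on $\mathbb{F}_q^k\setminus\{0\}$, independent of the erasures, and known to encoder and decoder; "almost surely" is over this choice and the erasures. Age: at time $t$ the instantaneous age is $\Delta_{\epsilon,\mathcal{C}}(t)=t-(m(l)+t_0^s)$, where $l$ is the most recent transmitted message decoded at or before time $t$; before the first decoding it equals $a_0+t$ for a fixed constant $a_0$. The average age is the almost sure limit $\Delta_{\epsilon,\mathcal{C}}=\lim_{\tau\to\infty}\frac1\tau\int_0^\tau\Delta_{\epsilon,\mathcal{C}}(t)\,dt$.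 $\Delta^{lin}_\epsilon$ is the infimum of $\Delta_{\epsilon,\mathcal{C}}$ over all blocklengths $n\ge k$ and all $(n,k)$-schemes induced by (deterministic) sequences of $(n,k)$-linear encoders for which the limit exists and is almost surely constant. *)

theory Defs
  imports "HOL-Probability.Probability"
begin

section \<open>Linear block codes\<close>

text \<open>
  The field with q elements is a type \<^typ>\<open>'q\<close> of classes field and finite, and messages are
  vectors over it indexed by a finite type \<^typ>\<open>'k\<close>, so q and k are the cardinalities of these
  types.  A sequence of encoders is a function G such that \<open>G l j\<close> is the j-th column of the
  generator matrix of block l; only \<open>l \<ge> 1\<close> and \<open>1 \<le> j \<le> n\<close> matter.  An erasure pattern is a
  function e such that \<open>e i\<close> holds iff channel use \<open>i \<ge> 1\<close> is erased.
\<close>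

definition encode :: "(nat \<Rightarrow> 'q::field ^ 'k) \<Rightarrow> 'q ^ 'k \<Rightarrow> nat \<Rightarrow> 'q" where
  "encode g u j = (\<Sum>i\<in>UNIV. u $ i * g j $ i)"

definition determined :: "(nat \<Rightarrow> 'q::field ^ 'k) \<Rightarrow> nat set \<Rightarrow> bool" where
  "determined g J \<longleftrightarrow> (\<forall>u v. (\<forall>j\<in>J. encode g u j = encode g v j) \<longrightarrow> u = v)"

lemma determined_iff_span:
  fixes g :: "nat \<Rightarrow> 'q::field ^ 'k"
  shows "determined g J \<longleftrightarrow> vec.span (g ` J) = UNIV"
proof
  assume det: "determined g J"
  show "vec.span (g ` J) = UNIV"
  proof (rule ccontr)
    assume "vec.span (g ` J) \<noteq> UNIV"
    then obtain x where x: "x \<notin> vec.span (g ` J)" by auto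
    obtain B where B: "B \<subseteq> g ` J" "vec.independent B" "g ` J \<subseteq> vec.span B"
      using vec.maximal_independent_subset[of "g ` J"] by blast
    have xB: "x \<notin> vec.span B"
      using x B(1) vec.span_mono by blast
    then have xB': "x \<notin> B" using vec.span_base by blast
    have "vec.independent (insert x B)"
      using xB B(2) by (simp add: vec.independent_insert)
    then obtain f :: "'q ^ 'k \<Rightarrow> 'q ^ 'k" where f: "Vector_Spaces.linear (*s) (*s) f"
      "\<forall>y\<in>insert x B. f y = (if y = x then (\<chi> i. 1) else 0)"
      using vec.linear_independent_extend[of "insert x B" "\<lambda>y. if y = x then (\<chi> i. 1) else (0 :: 'q ^ 'k)"] by blast
    define i :: 'k where "i = undefined"
    define u where "u = matrix f $ i"
    have fu: "(\<Sum>j\<in>UNIV. u $ j * y $ j) = f y $ i" for y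
    proof -
      have "f y = matrix f *v y" using f(1) by (simp add: matrix_works)
      then show ?thesis by (simp add: u_def matrix_vector_mult_def)
    qed
    have "f y = 0" if "y \<in> vec.span B" for y
    proof -
      have "f b = 0" if "b \<in> B" for b using f(2) that xB' by auto
      then show ?thesis using f(1) that by (rule_tac vec.linear_eq_0_on_span) auto
    qed
    then have "encode g u j = encode g 0 j" if "j \<in> J" for j
      using that B(3) by (auto simp: encode_def fu)
    then have "u = 0" using det by (auto simp: determined_def)
    then have "f x $ i = 0" using fu[of x] by simp
    then show False using f(2) by simp
  qed
next
  assume sp: "vec.span (g ` J) = UNIV"
  show "determined g J"
    unfolding determined_def
  proof (intro allI impI)
    fix u v :: "'q ^ 'k"
    assume eq: "\<forall>j\<in>J. encode g u j = encode g v j"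
    have "(\<Sum>i\<in>UNIV. (u $ i - v $ i) * y $ i) = 0" if "y \<in> vec.span (g ` J)" for y
      using that
    proof (induction rule: vec.span_induct_alt)
      case base then show ?case by simp
    next
      case (step c x y)
      have "(\<Sum>i\<in>UNIV. (u $ i - v $ i) * x $ i) = 0"
        using step(1) eq by (auto simp: encode_def left_diff_distrib sum_subtractf)
      moreover have "(\<Sum>i\<in>UNIV. (u $ i - v $ i) * (c *s x + y) $ i) =
          c * (\<Sum>i\<in>UNIV. (u $ i - v $ i) * x $ i) + (\<Sum>i\<in>UNIV. (u $ i - v $ i) * y $ i)"
        by (simp add: algebra_simps sum.distrib sum_distrib_left sum_subtractf)
      ultimately show ?case using step by simp
    qed
    then have *: "(\<Sum>i\<in>UNIV. (u $ i - v $ i) * axis j 1 $ i) = 0" for j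
      using sp by auto
    have "u $ j - v $ j = 0" for j
      using *[of j] by (simp add: axis_def if_distrib cong: if_cong)
    then show "u = v" by (simp add: vec_eq_iff)
  qed
qed


section \<open>Decoding and age\<close>

text \<open>Block l occupies the channel uses \<open>(l - 1) * n + 1, \<dots>, l * n\<close>; positions inside a block are
  numbered from 1.\<close>

definition received :: "nat \<Rightarrow> (nat \<Rightarrow> bool) \<Rightarrow> nat \<Rightarrow> nat \<Rightarrow> nat set" where
  "received n e l j = {i \<in> {1..j}. \<not> e ((l - 1) * n + i)}"

definition decoded_at ::
  "nat \<Rightarrow> (nat \<Rightarrow> nat \<Rightarrow> 'q::field ^ 'k) \<Rightarrow> (nat \<Rightarrow> bool) \<Rightarrow> nat \<Rightarrow> nat \<Rightarrow> bool" where
  "decoded_at n G e l j \<longleftrightarrow> j \<in> {1..n} \<and> determined (G l) (received n e l j) \<and>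
     (\<forall>i\<in>{1..<j}. \<not> determined (G l) (received n e l i))"

definition decoded_by ::
  "nat \<Rightarrow> (nat \<Rightarrow> nat \<Rightarrow> 'q::field ^ 'k) \<Rightarrow> (nat \<Rightarrow> bool) \<Rightarrow> real \<Rightarrow> nat set" where
  "decoded_by n G e t = {l. 1 \<le> l \<and> (\<exists>j. decoded_at n G e l j \<and> real ((l - 1) * n + j) \<le> t)}"

definition msg_index :: "real \<Rightarrow> nat \<Rightarrow> nat \<Rightarrow> int" where
  "msg_index t0 n l = \<lfloor>(real l - 1) * real n + 1 - t0\<rfloor>"

definition age ::
  "real \<Rightarrow> real \<Rightarrow> nat \<Rightarrow> (nat \<Rightarrow> nat \<Rightarrow> 'q::field ^ 'k) \<Rightarrow> (nat \<Rightarrow> bool) \<Rightarrow> real \<Rightarrow> real" where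
  "age t0 a0 n G e t =
     (if decoded_by n G e t = {} then a0 + t
      else t - (real_of_int (msg_index t0 n (Max (decoded_by n G e t))) + t0))"

definition has_average_age ::
  "real \<Rightarrow> real \<Rightarrow> nat \<Rightarrow> (nat \<Rightarrow> nat \<Rightarrow> 'q::field ^ 'k) \<Rightarrow> (nat \<Rightarrow> bool) \<Rightarrow> real \<Rightarrow> bool" where
  "has_average_age t0 a0 n G e \<delta> \<longleftrightarrow>
     ((\<lambda>\<tau>. 1 / \<tau> * integral {0..\<tau>} (age t0 a0 n G e)) \<longlongrightarrow> \<delta>) at_top"


section \<open>Random erasures and random columns\<close>

definition erasure_space :: "real \<Rightarrow> (nat \<Rightarrow> bool) measure" where
  "erasure_space \<epsilon> = PiM UNIV (\<lambda>_. measure_pmf (bernoulli_pmf \<epsilon>))"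

definition column_space :: "(nat \<times> nat \<Rightarrow> 'q::{field,finite} ^ 'k) measure" where
  "column_space = PiM UNIV (\<lambda>_. measure_pmf (pmf_of_set (UNIV - {0})))"

text \<open>The infimum is taken in the extended reals so that it needs no side conditions.\<close>

definition optimal_linear_age ::
  "('q::{field,finite} ^ 'k) itself \<Rightarrow> real \<Rightarrow> real \<Rightarrow> real \<Rightarrow> ereal" where
  "optimal_linear_age T \<epsilon> t0 a0 =
     Inf {ereal \<delta> | \<delta> n (G :: nat \<Rightarrow> nat \<Rightarrow> 'q ^ 'k).
            CARD('k) \<le> n \<and> (AE e in erasure_space \<epsilon>. has_average_age t0 a0 n G e \<delta>)}"


section \<open>The bounds\<close>

text \<open>The library's geometric distribution starts at 0, hence the shift by \<^const>\<open>Suc\<close>.\<close>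

definition geometric_sum_pmf :: "nat \<Rightarrow> real \<Rightarrow> nat pmf" where
  "geometric_sum_pmf r p = map_pmf sum_list (replicate_pmf r (map_pmf Suc (geometric_pmf p)))"

definition geometric_sum_cdf :: "nat \<Rightarrow> real \<Rightarrow> nat \<Rightarrow> real" where
  "geometric_sum_cdf r p n = measure_pmf.prob (geometric_sum_pmf r p) {..n}"

definition age_bound :: "real \<Rightarrow> nat \<Rightarrow> real \<Rightarrow> nat \<Rightarrow> real" where
  "age_bound p k t0 n =
     (2 * real n * p - p * (real n + 2) * geometric_sum_cdf k p n
        + 2 * real k * geometric_sum_cdf (k + 1) p (n + 1))
       / (2 * p * geometric_sum_cdf k p n)
     + frac (- t0)"

definition innovation_prob :: "nat \<Rightarrow> real \<Rightarrow> nat \<Rightarrow> real" where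
  "innovation_prob q \<epsilon> k = (1 - \<epsilon>) * (real q ^ (k - 1) * (real q - 1) / (real q ^ k - 1))"

definition age_lb :: "real \<Rightarrow> nat \<Rightarrow> real \<Rightarrow> nat \<Rightarrow> real" where
  "age_lb \<epsilon> k t0 n = age_bound (1 - \<epsilon>) k t0 n"

definition age_ub :: "nat \<Rightarrow> real \<Rightarrow> nat \<Rightarrow> real \<Rightarrow> nat \<Rightarrow> real" where
  "age_ub q \<epsilon> k t0 n = age_bound (innovation_prob q \<epsilon> k) k t0 n"

end

theory Submission
  imports Defs "HOL-Library.Discrete_Functions"
begin

text \<open>
  Let \<open>n\<close> be the block length, \<open>f = frac (- t0)\<close>, let \<open>M\<close> be the minimum of \<open>n\<close> and the position
  at which a block is decoded, and let \<open>D\<close> be the number of blocks since the last decoded one.  In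
  each block the age integrates to \<open>n\<^sup>2 / 2 - (1 - f) * n + n * D * M\<close>.  When blocks are independent
  and decoded by position \<open>j\<close> with probability \<open>F j\<close>, the variables \<open>D * (M - E M)\<close> and
  \<open>D * (1\<^bsub>lost\<^esub> - P lost)\<close> are orthogonal with bounded second moments, so a strong law for
  orthogonal variables gives the average age
  \<open>n / 2 - 1 + f + (\<Sum>j<n. 1 - F j) / F n\<close> almost surely.  This is decreasing in \<open>F\<close>.

  The rank of the received columns is a counter that increases from \<open>i\<close> to \<open>i + 1\<close> with a probability
  lying between that of the last innovation and \<open>1 - \<epsilon>\<close>, and the sums of geometric variables in the
  bounds are the times at which counters with these constant probabilities reach \<open>k\<close>.  Hence
  the upper bound.  The lower bounds hold path by path: no linear code decodes a block before
  its \<open>k\<close>-th received symbol.  Finally, by Fubini some deterministic choice of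
  columns attains the almost sure age of the random scheme.
\<close>


section \<open>A strong law for orthogonal random variables\<close>

text \<open>The \<open>D\<close> of different blocks are dependent, so \<open>D * M\<close> is no
  sequence of independent variables. But \<open>D\<close> is a function of the earlier blocks alone,
  so its product with a centred function of the current block is a martingale difference. With the
  indicator of loss, the recursion \<open>D' = 1 + lost * D\<close> then forces the averages of
  \<open>D\<close> to \<open>1 / F n\<close>; with \<open>M\<close>, the averages of
  \<open>D * M\<close> follow. For deterministic encoders there is no such computation: the columns
  may change from block to block, so the blocks have no common law. Hence the comparison, for each
  erasure pattern, with a decoder that is content with any \<open>k\<close> symbols. It has a common
  law, although over a small field no code need attain it. The sums of \<open>k + 1\<close>
  variables and the argument \<open>n + 1\<close> come from size-biasing. If B is the time of the
  \<open>k\<close>-th success, then \<open>n * F n - (\<Sum>j<n. F j)\<close> is the expectation of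
  B on the event that B is at most \<open>n\<close>, and j * P(B = j) = (k / p) * P(B' = j + 1) for
  the time B' of the success after it.\<close>

lemma (in prob_space) AE_tendsto_0_if_summable_expectation:
  fixes Z :: "nat \<Rightarrow> 'a \<Rightarrow> real"
  assumes int: "\<And>m. integrable M (Z m)" and nonneg: "\<And>m \<omega>. 0 \<le> Z m \<omega>"
    and le: "\<And>m. expectation (Z m) \<le> c m" and c: "summable c"
  shows "AE \<omega> in M. (\<lambda>m. Z m \<omega>) \<longlonglongrightarrow> 0"
proof -
  note [measurable] = borel_measurable_integrable[OF int]
  have c0: "0 \<le> c m" for m
    using order_trans[OF Bochner_Integration.integral_nonneg le[of m]] nonneg by simp
  \<comment> \<open>A series of nonnegative terms whose sum has finite expectation converges almost
    surely, so its terms tend to 0.\<close>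
  have "(\<integral>\<^sup>+\<omega>. (\<Sum>m. ennreal (Z m \<omega>)) \<partial>M) = (\<Sum>m. \<integral>\<^sup>+\<omega>. ennreal (Z m \<omega>) \<partial>M)"
    by (intro nn_integral_suminf) measurable
  also have "\<dots> = (\<Sum>m. ennreal (expectation (Z m)))"
    using int nonneg by (simp add: nn_integral_eq_integral)
  also have "\<dots> \<le> (\<Sum>m. ennreal (c m))"
    by (intro suminf_le ennreal_leI le) auto
  also have "\<dots> = ennreal (suminf c)"
    using c c0 by (intro suminf_ennreal2) auto
  finally have "(\<integral>\<^sup>+\<omega>. (\<Sum>m. ennreal (Z m \<omega>)) \<partial>M) \<noteq> \<infinity>"
    by (auto simp: top_unique)
  then have "AE \<omega> in M. (\<Sum>m. ennreal (Z m \<omega>)) \<noteq> \<infinity>"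
    by (intro nn_integral_PInf_AE) measurable
  then show ?thesis
    by eventually_elim (auto intro!: summable_LIMSEQ_zero summable_suminf_not_top nonneg)
qed

text \<open>Orthogonality bounds the second moment of the \<open>L\<close>-th average by
  \<open>C / L\<close>, which is not summable, whereas \<open>C / m ^ 2\<close> at
  \<open>L = m ^ 2\<close> is. The \<open>2 * m + 1\<close> terms from one square to the next are
  few enough for Cauchy-Schwarz.\<close>

lemma (in prob_space) orthogonal_strong_law:
  fixes Y :: "nat \<Rightarrow> 'a \<Rightarrow> real"
  assumes [measurable]: "\<And>i. Y i \<in> borel_measurable M"
    and int: "\<And>i. integrable M (\<lambda>\<omega>. (Y i \<omega>)\<^sup>2)"
    and bd: "\<And>i. expectation (\<lambda>\<omega>. (Y i \<omega>)\<^sup>2) \<le> C"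
    and orth: "\<And>i j. i < j \<Longrightarrow> expectation (\<lambda>\<omega>. Y i \<omega> * Y j \<omega>) = 0"
  shows "AE \<omega> in M. (\<lambda>L. (\<Sum>l<L. Y l \<omega>) / real L) \<longlonglongrightarrow> 0"
proof -
  \<comment> \<open>The partial sums are controlled along the squares, and the gaps between squares separately.\<close>
  define S where "S L \<omega> = (\<Sum>l<L. Y l \<omega>)" for L \<omega>
  define T where "T m \<omega> = (\<Sum>l=m\<^sup>2..<(Suc m)\<^sup>2. \<bar>Y l \<omega>\<bar>)" for m \<omega>
  have [measurable]: "S L \<in> borel_measurable M" "T L \<in> borel_measurable M" for L
    unfolding S_def T_def by measurable
  have C0: "0 \<le> C"
    using order_trans[OF Bochner_Integration.integral_nonneg bd[of 0]] by simp
  have intp: "integrable M (\<lambda>\<omega>. Y i \<omega> * Y j \<omega>)" for i j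
  proof (rule Bochner_Integration.integrable_bound[of M "\<lambda>\<omega>. (Y i \<omega>)\<^sup>2 + (Y j \<omega>)\<^sup>2"])
    have "\<bar>a * b\<bar> \<le> a\<^sup>2 + b\<^sup>2" for a b :: real
      using sum_squares_bound[of "\<bar>a\<bar>" "\<bar>b\<bar>"] mult_nonneg_nonneg[OF abs_ge_zero[of a] abs_ge_zero[of b]]
      unfolding abs_mult power2_abs by linarith
    then show "AE \<omega> in M. norm (Y i \<omega> * Y j \<omega>) \<le> norm ((Y i \<omega>)\<^sup>2 + (Y j \<omega>)\<^sup>2)"
      by auto
  qed (auto intro: int)
  have orth': "expectation (\<lambda>\<omega>. Y i \<omega> * Y j \<omega>) = 0" if "i \<noteq> j" for i j
    using orth[of i j] orth[of j i] that by (cases "i < j") (auto simp: mult.commute)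
  have S2: "(S L \<omega>)\<^sup>2 = (\<Sum>i<L. \<Sum>j<L. Y i \<omega> * Y j \<omega>)" for L \<omega>
    unfolding S_def power2_eq_square by (rule sum_product)
  have intS: "integrable M (\<lambda>\<omega>. (S L \<omega>)\<^sup>2)" for L
    unfolding S2 by (intro Bochner_Integration.integrable_sum intp)
  have ES: "expectation (\<lambda>\<omega>. (S L \<omega>)\<^sup>2) \<le> real L * C" for L
  proof -
    have "expectation (\<lambda>\<omega>. (S L \<omega>)\<^sup>2) = (\<Sum>i<L. \<Sum>j<L. expectation (\<lambda>\<omega>. Y i \<omega> * Y j \<omega>))"
      unfolding S2 by (simp add: intp Bochner_Integration.integral_sum)
    also have "\<dots> = (\<Sum>i<L. expectation (\<lambda>\<omega>. (Y i \<omega>)\<^sup>2))"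
    proof (intro sum.cong refl)
      fix i assume "i \<in> {..<L}"
      then have "(\<Sum>j<L. expectation (\<lambda>\<omega>. Y i \<omega> * Y j \<omega>))
          = (\<Sum>j<L. if j = i then expectation (\<lambda>\<omega>. Y i \<omega> * Y i \<omega>) else 0)"
        by (intro sum.cong) (auto simp: orth')
      also have "\<dots> = expectation (\<lambda>\<omega>. (Y i \<omega>)\<^sup>2)"
        using \<open>i \<in> {..<L}\<close> by (simp add: power2_eq_square)
      finally show "(\<Sum>j<L. expectation (\<lambda>\<omega>. Y i \<omega> * Y j \<omega>)) = expectation (\<lambda>\<omega>. (Y i \<omega>)\<^sup>2)" .
    qed
    also have "\<dots> \<le> (\<Sum>i<L. C)" by (intro sum_mono bd)
    finally show ?thesis by simp
  qed
  have card_sq: "card {m\<^sup>2..<(Suc m)\<^sup>2} = 2 * m + 1" for m :: nat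
    by (simp add: power2_eq_square)
  have rcard: "real (card {m\<^sup>2..<(Suc m)\<^sup>2}) = 2 * real m + 1" for m :: nat
    by (simp only: card_sq of_nat_add of_nat_mult of_nat_numeral of_nat_1)
  have T2: "(T m \<omega>)\<^sup>2 \<le> (2 * real m + 1) * (\<Sum>l=m\<^sup>2..<(Suc m)\<^sup>2. (Y l \<omega>)\<^sup>2)" for m \<omega>
    using Cauchy_Schwarz_ineq_sum[of "\<lambda>_. 1" "\<lambda>l. \<bar>Y l \<omega>\<bar>" "{m\<^sup>2..<(Suc m)\<^sup>2}"]
    by (simp only: T_def rcard power_one sum_constant mult_1 mult_1_right power2_abs)
  have intT: "integrable M (\<lambda>\<omega>. (T m \<omega>)\<^sup>2)" for m
  proof (rule Bochner_Integration.integrable_bound)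
    show "integrable M (\<lambda>\<omega>. (2 * real m + 1) * (\<Sum>l=m\<^sup>2..<(Suc m)\<^sup>2. (Y l \<omega>)\<^sup>2))"
      by (intro integrable_mult_right Bochner_Integration.integrable_sum int)
    show "AE \<omega> in M. norm ((T m \<omega>)\<^sup>2) \<le>
        norm ((2 * real m + 1) * (\<Sum>l=m\<^sup>2..<(Suc m)\<^sup>2. (Y l \<omega>)\<^sup>2))"
      by (intro always_eventually allI) (auto intro!: order_trans[OF T2 abs_ge_self])
  qed measurable
  have ET: "expectation (\<lambda>\<omega>. (T m \<omega>)\<^sup>2) \<le> (2 * real m + 1)\<^sup>2 * C" for m
  proof -
    have "expectation (\<lambda>\<omega>. (T m \<omega>)\<^sup>2) \<le>
        expectation (\<lambda>\<omega>. (2 * real m + 1) * (\<Sum>l=m\<^sup>2..<(Suc m)\<^sup>2. (Y l \<omega>)\<^sup>2))"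
      by (intro integral_mono intT T2 integrable_mult_right Bochner_Integration.integrable_sum int)
    also have "\<dots> = (2 * real m + 1) * (\<Sum>l=m\<^sup>2..<(Suc m)\<^sup>2. expectation (\<lambda>\<omega>. (Y l \<omega>)\<^sup>2))"
      by (simp add: int Bochner_Integration.integral_sum)
    also have "\<dots> \<le> (2 * real m + 1) * (\<Sum>l=m\<^sup>2..<(Suc m)\<^sup>2. C)"
      by (intro mult_left_mono sum_mono bd) auto
    also have "\<dots> = (2 * real m + 1)\<^sup>2 * C"
      unfolding sum_constant rcard by (simp add: power2_eq_square)
    finally show ?thesis .
  qed
  \<comment> \<open>The 9 comes from \<open>2 * m + 1 \<le> 3 * m\<close> for positive
    \<open>m\<close>. At \<open>m = 0\<close> both sides of \<open>le9\<close> vanish because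
    division by zero gives 0.\<close>
  have sm: "summable (\<lambda>m. 9 * C * inverse (real m ^ 2))"
    by (intro summable_mult inverse_power_summable) auto
  have le9: "x / (real m ^ 2)\<^sup>2 \<le> 9 * C * inverse (real m ^ 2)"
    if "x \<le> 9 * C * real m ^ 2" for x m
  proof (cases "m = 0")
    case False
    have "x / (real m ^ 2)\<^sup>2 \<le> (9 * C * real m ^ 2) / (real m ^ 2)\<^sup>2"
      using that by (intro divide_right_mono) auto
    also have "\<dots> = 9 * C * inverse (real m ^ 2)"
      using False by (simp add: field_simps power2_eq_square)
    finally show ?thesis .
  qed auto
  have "AE \<omega> in M. (\<lambda>m. (S (m\<^sup>2) \<omega>)\<^sup>2 / (real m ^ 2)\<^sup>2) \<longlonglongrightarrow> 0"
  proof (rule AE_tendsto_0_if_summable_expectation[OF _ _ _ sm])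
    fix m
    have "real m ^ 2 * C \<le> 9 * C * real m ^ 2"
      using mult_nonneg_nonneg[OF C0 zero_le_power2[of "real m"]] by (simp add: algebra_simps)
    then have "expectation (\<lambda>\<omega>. (S (m\<^sup>2) \<omega>)\<^sup>2) \<le> 9 * C * real m ^ 2"
      by (rule order_trans[OF ES[of "m\<^sup>2", unfolded of_nat_power]])
    then show "expectation (\<lambda>\<omega>. (S (m\<^sup>2) \<omega>)\<^sup>2 / (real m ^ 2)\<^sup>2) \<le> 9 * C * inverse (real m ^ 2)"
      using le9 by simp
  qed (auto intro: intS)
  moreover have "AE \<omega> in M. (\<lambda>m. (T m \<omega>)\<^sup>2 / (real m ^ 2)\<^sup>2) \<longlonglongrightarrow> 0"
  proof (rule AE_tendsto_0_if_summable_expectation[OF _ _ _ sm])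
    fix m
    show "expectation (\<lambda>\<omega>. (T m \<omega>)\<^sup>2 / (real m ^ 2)\<^sup>2) \<le> 9 * C * inverse (real m ^ 2)"
    proof (cases "m = 0")
      case False
      then have "(2 * real m + 1)\<^sup>2 \<le> (3 * real m)\<^sup>2" by (intro power_mono) auto
      then have "(2 * real m + 1)\<^sup>2 * C \<le> 9 * C * real m ^ 2"
        using mult_right_mono[OF _ C0] by (fastforce simp: power_mult_distrib mult_ac)
      then have "expectation (\<lambda>\<omega>. (T m \<omega>)\<^sup>2) \<le> 9 * C * real m ^ 2"
        using ET[of m] by linarith
      then show ?thesis
        using le9 by simp
    qed auto
  qed (auto intro: intT)
  ultimately show ?thesis
  proof eventually_elim
    case (elim \<omega>)
    let ?U = "\<lambda>m. \<bar>S (m\<^sup>2) \<omega>\<bar> / real m ^ 2 + \<bar>T m \<omega>\<bar> / real m ^ 2"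
    have sq: "(\<lambda>m. \<bar>a m\<bar> / real m ^ 2) \<longlonglongrightarrow> 0"
      if "(\<lambda>m. (a m)\<^sup>2 / (real m ^ 2)\<^sup>2) \<longlonglongrightarrow> 0" for a :: "nat \<Rightarrow> real"
      using tendsto_real_sqrt[OF that] by (simp only: real_sqrt_divide real_sqrt_abs real_sqrt_zero abs_power2)
    have "?U \<longlonglongrightarrow> 0"
      using tendsto_add[OF sq[OF elim(1)] sq[OF elim(2)]] by simp
    moreover have "filterlim floor_sqrt at_top sequentially"
      unfolding filterlim_at_top
    proof
      fix Z :: nat
      show "\<forall>\<^sub>F x in sequentially. Z \<le> floor_sqrt x"
        using eventually_ge_at_top[of "Z\<^sup>2"]
        by eventually_elim (simp add: floor_sqrt_le_iff le_floor_sqrt_iff)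
    qed
    ultimately have lim: "(\<lambda>L. ?U (floor_sqrt L)) \<longlonglongrightarrow> 0"
      by (rule filterlim_compose)
    show ?case
    proof (rule Lim_null_comparison[OF _ lim])
      show "\<forall>\<^sub>F L in sequentially. norm ((\<Sum>l<L. Y l \<omega>) / real L) \<le> ?U (floor_sqrt L)"
        using eventually_gt_at_top[of 0]
      proof eventually_elim
        case (elim L)
        let ?m = "floor_sqrt L"
        have m: "?m\<^sup>2 \<le> L" "L < (Suc ?m)\<^sup>2"
          using Suc_floor_sqrt_power2_gt by auto
        have m0: "0 < ?m" using elim by simp
        have "{..<L} = {..<?m\<^sup>2} \<union> {?m\<^sup>2..<L}" by (rule ivl_disj_un_one(2)[OF m(1), symmetric])
        then have "(\<Sum>l<L. Y l \<omega>) = S (?m\<^sup>2) \<omega> + (\<Sum>l=?m\<^sup>2..<L. Y l \<omega>)"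
          unfolding S_def by (simp add: sum.union_disjoint ivl_disj_int)
        also have "\<bar>\<dots>\<bar> \<le> \<bar>S (?m\<^sup>2) \<omega>\<bar> + (\<Sum>l=?m\<^sup>2..<L. \<bar>Y l \<omega>\<bar>)"
          using sum_abs[of "\<lambda>l. Y l \<omega>" "{?m\<^sup>2..<L}"] by linarith
        also have "(\<Sum>l=?m\<^sup>2..<L. \<bar>Y l \<omega>\<bar>) \<le> T ?m \<omega>"
          unfolding T_def by (intro sum_mono2 ivl_subset[THEN iffD2]) (use m(2) in auto)
        finally have *: "\<bar>\<Sum>l<L. Y l \<omega>\<bar> \<le> \<bar>S (?m\<^sup>2) \<omega>\<bar> + \<bar>T ?m \<omega>\<bar>" by linarith
        have "norm ((\<Sum>l<L. Y l \<omega>) / real L) \<le> (\<bar>S (?m\<^sup>2) \<omega>\<bar> + \<bar>T ?m \<omega>\<bar>) / real L"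
          using * by (simp add: divide_right_mono)
        also have "\<dots> \<le> (\<bar>S (?m\<^sup>2) \<omega>\<bar> + \<bar>T ?m \<omega>\<bar>) / real (?m\<^sup>2)"
          using m(1) m0 by (intro divide_left_mono of_nat_mono) auto
        finally show ?case by (simp add: add_divide_distrib)
      qed
    qed
  qed
qed


section \<open>Gaps between decoded blocks\<close>

text \<open>\<open>f\<close> and \<open>g\<close> receive the whole family but may only look at the
  indices in \<open>A\<close> and \<open>B\<close>, so a recursive function such as
  \<open>gap\<close> can be inserted without restricting its argument. Finite products of discrete
  countable spaces are discrete, which makes \<open>f\<close> and \<open>g\<close>
  measurable.\<close>

lemma (in prob_space) indep_var_disjoint_parts:
  fixes W :: "'i \<Rightarrow> 'a \<Rightarrow> 'w::countable"
  assumes W: "indep_vars (\<lambda>_. count_space UNIV) W I"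
    and AB: "finite A" "finite B" "A \<inter> B = {}" "A \<subseteq> I" "B \<subseteq> I"
    and f: "\<And>x y. (\<And>i. i \<in> A \<Longrightarrow> x i = y i) \<Longrightarrow> f x = f y" "\<And>x. f x \<in> space S"
    and g: "\<And>x y. (\<And>i. i \<in> B \<Longrightarrow> x i = y i) \<Longrightarrow> g x = g y" "\<And>x. g x \<in> space T"
  shows "indep_var S (\<lambda>\<omega>. f (\<lambda>i. W i \<omega>)) T (\<lambda>\<omega>. g (\<lambda>i. W i \<omega>))"
proof -
  have "indep_var S (f \<circ> (\<lambda>\<omega>. restrict (\<lambda>i. W i \<omega>) A)) T (g \<circ> (\<lambda>\<omega>. restrict (\<lambda>i. W i \<omega>) B))"
    using AB f(2) g(2)
    by (intro indep_var_compose[OF indep_var_restrict[OF W]])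
       (auto simp: count_space_PiM_finite)
  moreover have "f (restrict x A) = f x" "g (restrict x B) = g x" for x
    by (auto intro!: f(1) g(1))
  ultimately show ?thesis by (simp add: comp_def)
qed

text \<open>Block \<open>i\<close> is decoded iff \<open>N i \<le> n\<close>.  Then \<open>gap n N l\<close> is the distance from the last decoded
  block before \<open>l\<close> to \<open>l\<close>, with a fictitious decoded block just before block 0.\<close>

primrec gap :: "nat \<Rightarrow> (nat \<Rightarrow> nat) \<Rightarrow> nat \<Rightarrow> nat" where
  "gap n N 0 = 1"
| "gap n N (Suc l) = 1 + (if N l \<le> n then 0 else gap n N l)"

lemma gap_cong: "(\<And>i. i < l \<Longrightarrow> N i = N' i) \<Longrightarrow> gap n N l = gap n N' l"
  by (induction l) auto

lemma gap_le: "gap n N l \<le> Suc l"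
  by (induction l) auto

text \<open>\<open>gap n N l\<close> looks only at the blocks before \<open>l\<close>, hence is
  independent of \<open>N l\<close>. In the limit, \<open>\<Sum>j<n. 1 - F j\<close> is the
  expectation of \<open>min (N l) n\<close> and \<open>1 / F n\<close> the average gap. The law of
  \<open>N l\<close> is prescribed up to \<open>n\<close>, since every larger value means that the
  block is lost.\<close>

lemma (in prob_space)
  fixes N :: "nat \<Rightarrow> 'a \<Rightarrow> nat"
  assumes N: "indep_vars (\<lambda>_. count_space UNIV) N UNIV"
    and F: "\<And>l j. j \<le> n \<Longrightarrow> prob {\<omega> \<in> space M. N l \<omega> \<le> j} = F j" and P: "0 < F n"
  shows gap_sublinear: "AE \<omega> in M. (\<lambda>L. real (gap n (\<lambda>i. N i \<omega>) L) / real L) \<longlonglongrightarrow> 0"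
    and gap_average: "AE \<omega> in M. (\<lambda>L. (\<Sum>l<L. real (gap n (\<lambda>i. N i \<omega>) l) * real (min (N l \<omega>) n)) / real L)
                        \<longlonglongrightarrow> (\<Sum>j<n. 1 - F j) / F n"
proof -
  have N_meas [measurable]: "N l \<in> M \<rightarrow>\<^sub>M count_space UNIV" for l
    using N by (auto simp: indep_vars_def)
  define D where "D l \<omega> = real (gap n (\<lambda>i. N i \<omega>) l)" for l \<omega>
  define \<phi> where "\<phi> = 1 - F n"
  define fl where "fl x = (if x \<le> n then 0 else 1 :: real)" for x :: nat
  have D_Suc: "D (Suc l) \<omega> = 1 + fl (N l \<omega>) * D l \<omega>" for l \<omega>
    by (simp add: D_def fl_def)
  have D_le: "D l \<omega> \<le> 1 + real l" for l \<omega>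
    using of_nat_mono[OF gap_le[of n "\<lambda>i. N i \<omega>" l], where 'a=real] by (simp add: D_def)
  have D_nonneg: "0 \<le> D l \<omega>" for l \<omega> by (simp add: D_def)
  have D_meas [measurable]: "D l \<in> borel_measurable M" for l
  proof (induction l)
    case 0 show ?case by (simp add: D_def)
  next
    case (Suc l)
    note [measurable] = Suc.IH
    show ?case unfolding D_Suc[abs_def] by measurable
  qed
  have le1: "F n \<le> 1" using F[of n 0] prob_le_1[of "{\<omega> \<in> space M. N 0 \<omega> \<le> n}"] by simp
  then have \<phi>: "0 \<le> \<phi>" "\<phi> < 1" using P by (auto simp: \<phi>_def)
  have int_bdd: "integrable M X" if [measurable]: "X \<in> borel_measurable M" and "\<And>\<omega>. \<bar>X \<omega>\<bar> \<le> c" for X :: "'a \<Rightarrow> real" and c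
    using that(2) by (intro integrable_const_bound[of _ c]) auto
  have tail: "expectation (\<lambda>\<omega>. if N l \<omega> \<le> j then 0 else 1 :: real) = 1 - F j" if "j \<le> n" for l j
  proof -
    have "expectation (\<lambda>\<omega>. if N l \<omega> \<le> j then 0 else 1 :: real)
        = expectation (\<lambda>\<omega>. 1 - indicat_real {\<omega> \<in> space M. N l \<omega> \<le> j} \<omega>)"
      by (intro Bochner_Integration.integral_cong) auto
    also have "\<dots> = 1 - prob {\<omega> \<in> space M. N l \<omega> \<le> j}"
      using int_bdd[of "indicat_real {\<omega> \<in> space M. N l \<omega> \<le> j}" 1]
      by (subst Bochner_Integration.integral_diff) (simp_all add: prob_space)
    finally show ?thesis by (simp add: F that)
  qed
  have Efl: "expectation (\<lambda>\<omega>. fl (N l \<omega>)) = \<phi>" for l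
    using tail[of n l] by (simp add: fl_def \<phi>_def)
  \<comment> \<open>All moments below are computed with this factorization into a function of the
    past and a function of the current block.\<close>
  have past: "expectation (\<lambda>\<omega>. h (\<lambda>i. N i \<omega>) * g (N l \<omega>)) = expectation (\<lambda>\<omega>. h (\<lambda>i. N i \<omega>)) * expectation (\<lambda>\<omega>. g (N l \<omega>))"
    if h: "\<And>x y. (\<And>i. i < l \<Longrightarrow> x i = y i) \<Longrightarrow> h x = h y" "integrable M (\<lambda>\<omega>. h (\<lambda>i. N i \<omega>))"
      and g: "integrable M (\<lambda>\<omega>. g (N l \<omega>))" for h g :: "_ \<Rightarrow> real" and l
  proof (rule indep_var_lebesgue_integral[OF _ h(2) g])
    show "indep_var borel (\<lambda>\<omega>. h (\<lambda>i. N i \<omega>)) borel (\<lambda>\<omega>. g (N l \<omega>))"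
      by (rule indep_var_disjoint_parts[OF N, of "{..<l}" "{l}" _ _ "\<lambda>x. g (x l)", simplified])
         (auto intro: h(1))
  qed
  have intD: "integrable M (\<lambda>\<omega>. D l \<omega>)" for l
    using D_le D_nonneg by (intro int_bdd[of _ "1 + real l"]) (auto simp: abs_of_nonneg)
  have intD2: "integrable M (\<lambda>\<omega>. (D l \<omega>)\<^sup>2)" for l
    using D_le D_nonneg by (intro int_bdd[of _ "(1 + real l)\<^sup>2"]) (auto intro!: power_mono)
  have int_fl: "integrable M (\<lambda>\<omega>. fl (N l \<omega>))" for l
    by (intro int_bdd[of _ 1]) (auto simp: fl_def)
  have EfD: "expectation (\<lambda>\<omega>. D l \<omega> * fl (N l \<omega>)) = \<phi> * expectation (D l)" for l
    using past[of l "\<lambda>x. real (gap n x l)" fl, OF arg_cong[OF gap_cong]] intD[of l] int_fl[of l]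
    by (simp add: D_def[abs_def] Efl)
  have EfD2: "expectation (\<lambda>\<omega>. (D l \<omega>)\<^sup>2 * fl (N l \<omega>)) = \<phi> * expectation (\<lambda>\<omega>. (D l \<omega>)\<^sup>2)" for l
    using past[of l "\<lambda>x. (real (gap n x l))\<^sup>2" fl, OF arg_cong[OF gap_cong]] intD2[of l] int_fl[of l]
    by (simp add: D_def[abs_def] Efl)
  have int_fD: "integrable M (\<lambda>\<omega>. D l \<omega> * fl (N l \<omega>))" "integrable M (\<lambda>\<omega>. (D l \<omega>)\<^sup>2 * fl (N l \<omega>))" for l
    by (rule Bochner_Integration.integrable_bound[OF intD[of l]], auto simp: fl_def)
       (rule Bochner_Integration.integrable_bound[OF intD2[of l]], auto simp: fl_def)
  have ED: "expectation (D l) \<le> 1 / F n" for l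
  proof (induction l)
    case 0 then show ?case using le1 P by (simp add: D_def[abs_def] prob_space)
  next
    case (Suc l)
    have "expectation (D (Suc l)) = expectation (\<lambda>\<omega>. 1 + D l \<omega> * fl (N l \<omega>))"
      unfolding D_Suc[abs_def] by (simp add: mult.commute)
    also have "\<dots> = 1 + \<phi> * expectation (D l)"
      using int_fD(1) by (simp add: EfD prob_space)
    also have "\<dots> \<le> 1 + \<phi> * (1 / F n)" using \<phi> Suc by (intro add_left_mono mult_left_mono) auto
    also have "\<dots> = 1 / F n" using P by (simp add: \<phi>_def field_simps)
    finally show ?case .
  qed
  \<comment> \<open>\<open>C\<close> solves \<open>x = 1 + 2 * \<phi> / F n + \<phi> * x\<close>,
    the recursion of the second moments with the first moment replaced by its bound
    \<open>1 / F n\<close>, which is itself the fixed point of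
    \<open>x = 1 + \<phi> * x\<close>.\<close>
  define C where "C = (1 + 2 * \<phi> / F n) / F n"
  have ED2: "expectation (\<lambda>\<omega>. (D l \<omega>)\<^sup>2) \<le> C" for l
  proof (induction l)
    case 0
    have "F n * F n \<le> 1 * F n" using le1 P by (intro mult_right_mono) auto
    moreover have "0 \<le> 2 * \<phi> / F n" using P \<phi> by simp
    ultimately have "F n * 1 \<le> 1 + 2 * \<phi> / F n" using le1 by linarith
    then have "1 \<le> C" unfolding C_def using P by (simp only: pos_le_divide_eq mult.commute)
    then show ?case by (simp add: D_def prob_space)
  next
    case (Suc l)
    have fl2: "(fl x)\<^sup>2 = fl x" for x by (simp add: fl_def)
    have "expectation (\<lambda>\<omega>. (D (Suc l) \<omega>)\<^sup>2) =
        expectation (\<lambda>\<omega>. 1 + 2 * (D l \<omega> * fl (N l \<omega>)) + (D l \<omega>)\<^sup>2 * fl (N l \<omega>))"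
      unfolding D_Suc[abs_def] power2_sum power_mult_distrib fl2 by (simp add: algebra_simps)
    also have "\<dots> = 1 + 2 * \<phi> * expectation (D l) + \<phi> * expectation (\<lambda>\<omega>. (D l \<omega>)\<^sup>2)"
      using int_fD by (simp add: EfD EfD2 prob_space)
    also have "\<dots> \<le> 1 + 2 * \<phi> * (1 / F n) + \<phi> * C"
      using \<phi> Suc ED by (intro add_mono mult_left_mono) auto
    also have "\<dots> = C * F n + \<phi> * C" using P by (simp add: C_def)
    also have "\<dots> = C" by (simp add: \<phi>_def algebra_simps)
    finally show ?case .
  qed
  have C0: "0 \<le> C" using P \<phi> by (simp add: C_def)
  have mart: "AE \<omega> in M. (\<lambda>L. (\<Sum>l<L. D l \<omega> * (g (N l \<omega>) - \<mu>)) / real L) \<longlonglongrightarrow> 0"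
    if g: "\<And>x. \<bar>g x\<bar> \<le> B" and \<mu>: "\<And>l. expectation (\<lambda>\<omega>. g (N l \<omega>)) = \<mu>" for g and B \<mu> :: real
  proof -
    define G where "G x = g x - \<mu>" for x
    have G: "\<bar>G x\<bar> \<le> B + \<bar>\<mu>\<bar>" for x using g[of x] unfolding G_def by linarith
    have gint: "integrable M (\<lambda>\<omega>. g (N l \<omega>))" for l
      by (rule int_bdd[of _ B]) (auto simp: g)
    have Gint: "integrable M (\<lambda>\<omega>. G (N l \<omega>))" for l
      by (rule int_bdd[of _ "B + \<bar>\<mu>\<bar>"]) (auto simp: G)
    have EG: "expectation (\<lambda>\<omega>. G (N l \<omega>)) = 0" for l
      unfolding G_def using gint \<mu> by (simp add: prob_space)
    have b: "(D l \<omega> * G (N l \<omega>))\<^sup>2 \<le> (B + \<bar>\<mu>\<bar>)\<^sup>2 * (D l \<omega>)\<^sup>2" for l \<omega>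
    proof -
      have "(G (N l \<omega>))\<^sup>2 \<le> (B + \<bar>\<mu>\<bar>)\<^sup>2" using power_mono[OF G[of "N l \<omega>"], of 2] by simp
      then show ?thesis by (simp add: power_mult_distrib mult.commute mult_left_mono)
    qed
    have bi: "integrable M (\<lambda>\<omega>. (D l \<omega> * G (N l \<omega>))\<^sup>2)" for l
      by (rule Bochner_Integration.integrable_bound[OF integrable_mult_right[OF intD2[of l], of "(B + \<bar>\<mu>\<bar>)\<^sup>2"]])
         (auto simp: b)
    have "AE \<omega> in M. (\<lambda>L. (\<Sum>l<L. D l \<omega> * G (N l \<omega>)) / real L) \<longlonglongrightarrow> 0"
    proof (rule orthogonal_strong_law[OF _ bi])
      fix l
      have "expectation (\<lambda>\<omega>. (D l \<omega> * G (N l \<omega>))\<^sup>2) \<le> expectation (\<lambda>\<omega>. (B + \<bar>\<mu>\<bar>)\<^sup>2 * (D l \<omega>)\<^sup>2)"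
        by (intro integral_mono bi b integrable_mult_right intD2)
      also have "\<dots> \<le> (B + \<bar>\<mu>\<bar>)\<^sup>2 * C"
        using ED2[of l] by (simp add: mult_left_mono)
      finally show "expectation (\<lambda>\<omega>. (D l \<omega> * G (N l \<omega>))\<^sup>2) \<le> (B + \<bar>\<mu>\<bar>)\<^sup>2 * C" .
    next
      fix i j :: nat assume ij: "i < j"
      \<comment> \<open>\<open>h\<close> collects all factors except \<open>G (N j)\<close>. As
        \<open>i < j\<close>, they are determined by the blocks before \<open>j\<close>, so the
        centred last factor splits off and the expectation vanishes.\<close>
      define h where "h x = real (gap n x i) * G (x i) * real (gap n x j)" for x
      have hN: "h (\<lambda>i. N i \<omega>) = D i \<omega> * G (N i \<omega>) * D j \<omega>" for \<omega>
        by (simp add: h_def D_def)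
      have "expectation (\<lambda>\<omega>. h (\<lambda>i. N i \<omega>) * G (N j \<omega>)) = expectation (\<lambda>\<omega>. h (\<lambda>i. N i \<omega>)) * expectation (\<lambda>\<omega>. G (N j \<omega>))"
      proof (rule past)
        fix x y :: "nat \<Rightarrow> nat" assume eq: "\<And>i. i < j \<Longrightarrow> x i = y i"
        then have "gap n x i = gap n y i" "gap n x j = gap n y j" "x i = y i"
          using ij by (auto intro!: gap_cong)
        then show "h x = h y" by (simp add: h_def)
      next
        show "integrable M (\<lambda>\<omega>. h (\<lambda>i. N i \<omega>))"
          unfolding hN
        proof (rule int_bdd)
          fix \<omega> show "\<bar>D i \<omega> * G (N i \<omega>) * D j \<omega>\<bar> \<le> (1 + real i) * (B + \<bar>\<mu>\<bar>) * (1 + real j)"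
            unfolding abs_mult using G D_le D_nonneg g[of 0]
            by (intro mult_mono mult_nonneg_nonneg) (auto simp: abs_of_nonneg)
        qed measurable
      qed (rule Gint)
      then show "expectation (\<lambda>\<omega>. D i \<omega> * G (N i \<omega>) * (D j \<omega> * G (N j \<omega>))) = 0"
        by (simp add: hN EG mult.assoc)
    qed measurable
    then show ?thesis by (simp add: G_def)
  qed
  have "AE \<omega> in M. (\<lambda>L. (D L \<omega> / real L)\<^sup>2) \<longlonglongrightarrow> 0"
  proof (rule AE_tendsto_0_if_summable_expectation)
    show "summable (\<lambda>m. C * inverse (real m ^ 2))"
      by (intro summable_mult inverse_power_summable) auto
    show "expectation (\<lambda>\<omega>. (D L \<omega> / real L)\<^sup>2) \<le> C * inverse (real L ^ 2)" for L
      using divide_right_mono[OF ED2[of L] zero_le_power2[of "real L"]] by (simp add: power_divide divide_inverse[symmetric])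
  qed (auto simp: power_divide intD2)
  then have sub: "AE \<omega> in M. (\<lambda>L. D L \<omega> / real L) \<longlonglongrightarrow> 0"
  proof eventually_elim
    case (elim \<omega>)
    then show ?case using tendsto_real_sqrt[OF elim] by (simp add: tendsto_rabs_zero_iff)
  qed
  then show "AE \<omega> in M. (\<lambda>L. real (gap n (\<lambda>i. N i \<omega>) L) / real L) \<longlonglongrightarrow> 0"
    by (simp add: D_def)
  define \<mu> where "\<mu> = (\<Sum>j<n. 1 - F j)"
  \<comment> \<open>A sum of tail indicators, whose expectations are the
    \<open>1 - F j\<close>.\<close>
  have min_eq: "real (min x n) = (\<Sum>j<n. if x \<le> j then 0 else 1)" for x
  proof -
    have "(\<Sum>j<n. if x \<le> j then 0 else 1 :: real) = (\<Sum>j\<in>{..<min x n}. 1)"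
      by (intro sum.mono_neutral_cong_right) auto
    then show ?thesis by simp
  qed
  have E\<mu>: "expectation (\<lambda>\<omega>. real (min (N l \<omega>) n)) = \<mu>" for l
  proof -
    have "integrable M (\<lambda>\<omega>. if N l \<omega> \<le> j then 0 else 1 :: real)" for j
      by (rule int_bdd[of _ 1]) auto
    then show ?thesis unfolding min_eq \<mu>_def by (subst Bochner_Integration.integral_sum) (auto simp: tail)
  qed
  have "AE \<omega> in M. (\<lambda>L. (\<Sum>l<L. D l \<omega> * (fl (N l \<omega>) - \<phi>)) / real L) \<longlonglongrightarrow> 0"
    by (rule mart[of _ 1, OF _ Efl]) (simp add: fl_def)
  moreover have "AE \<omega> in M. (\<lambda>L. (\<Sum>l<L. D l \<omega> * (real (min (N l \<omega>) n) - \<mu>)) / real L) \<longlonglongrightarrow> 0"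
    by (rule mart[of _ "real n", OF _ E\<mu>]) simp
  ultimately have "AE \<omega> in M. (\<lambda>L. (\<Sum>l<L. D l \<omega> * real (min (N l \<omega>) n)) / real L) \<longlonglongrightarrow> \<mu> / F n"
    using sub
  proof eventually_elim
    case (elim \<omega>)
    \<comment> \<open>\<open>D (Suc l) = 1 + fl * D l\<close>, so up to boundary terms the sum of the \<open>D l\<close> satisfies
      \<open>S = L + \<phi> * S\<close> plus a sum that is negligible by \<open>mart\<close>.\<close>
    let ?S = "\<lambda>L. \<Sum>l<L. D l \<omega>"
    have id: "F n * ?S L = real L + (\<Sum>l<L. D l \<omega> * (fl (N l \<omega>) - \<phi>)) - D L \<omega> + 1" for L
    proof (induction L)
      case 0 then show ?case by (simp add: D_def)
    next
      case (Suc L)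
      then show ?case by (simp add: D_Suc algebra_simps \<phi>_def)
    qed
    have "(\<lambda>L. 1 + (\<Sum>l<L. D l \<omega> * (fl (N l \<omega>) - \<phi>)) / real L - D L \<omega> / real L + 1 / real L) \<longlonglongrightarrow> 1 + 0 - 0 + 0"
      by (intro tendsto_intros elim lim_1_over_n)
    moreover have "\<forall>\<^sub>F L in sequentially. 1 + (\<Sum>l<L. D l \<omega> * (fl (N l \<omega>) - \<phi>)) / real L
        - D L \<omega> / real L + 1 / real L = F n * ?S L / real L"
      using eventually_gt_at_top[of 0]
      by eventually_elim (simp add: id add_divide_distrib diff_divide_distrib)
    ultimately have "(\<lambda>L. F n * ?S L / real L) \<longlonglongrightarrow> 1"
      by (auto dest: Lim_transform_eventually)
    then have "(\<lambda>L. \<mu> / F n * (F n * ?S L / real L) + (\<Sum>l<L. D l \<omega> * (real (min (N l \<omega>) n) - \<mu>)) / real L) \<longlonglongrightarrow> \<mu> / F n * 1 + 0"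
      by (intro tendsto_intros elim)
    moreover have "\<mu> / F n * (F n * ?S L / real L) + (\<Sum>l<L. D l \<omega> * (real (min (N l \<omega>) n) - \<mu>)) / real L
        = (\<Sum>l<L. D l \<omega> * real (min (N l \<omega>) n)) / real L" for L
      using P by (simp add: algebra_simps sum_subtractf sum_distrib_left sum_distrib_right flip: add_divide_distrib)
    ultimately show ?case by simp
  qed
  then show "AE \<omega> in M. (\<lambda>L. (\<Sum>l<L. real (gap n (\<lambda>i. N i \<omega>) l) * real (min (N l \<omega>) n)) / real L)
      \<longlonglongrightarrow> (\<Sum>j<n. 1 - F j) / F n"
    by (simp add: D_def \<mu>_def)
qed


section \<open>Hitting probabilities and the age bounds\<close>

text \<open>\<open>hit p j i\<close> is the probability that a counter which moves from \<open>m\<close> to \<open>m + 1\<close> with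
  probability \<open>p m\<close> in every step has reached \<open>i\<close> after \<open>j\<close> steps.\<close>

fun hit :: "(nat \<Rightarrow> real) \<Rightarrow> nat \<Rightarrow> nat \<Rightarrow> real" where
  "hit p j 0 = 1"
| "hit p 0 (Suc i) = 0"
| "hit p (Suc j) (Suc i) = p i * hit p j i + (1 - p i) * hit p j (Suc i)"

section \<open>Monotonicity of hitting probabilities\<close>

lemma convex_combination_bounds:
  fixes a b c :: real
  assumes "0 \<le> c" "c \<le> 1" "b \<le> a"
  shows "c * a + (1 - c) * b \<le> a" and "b \<le> c * a + (1 - c) * b"
proof -
  have "0 \<le> (1 - c) * (a - b)" "0 \<le> c * (a - b)" using assms by auto
  then show "c * a + (1 - c) * b \<le> a" "b \<le> c * a + (1 - c) * b"
    by (auto simp: algebra_simps)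
qed

text \<open>In the successor case \<open>hit p j i\<close> separates the two sides: one step raises
  the counter by at most one and never lowers it.\<close>

lemma hit_antimono_Suc:
  assumes "\<And>i. 0 \<le> p i \<and> p i \<le> 1"
  shows "hit p j (Suc i) \<le> hit p j i"
proof (induction j arbitrary: i)
  case 0 then show ?case by (cases i) auto
next
  case (Suc j)
  have "hit p (Suc j) (Suc i) \<le> hit p j i"
    using convex_combination_bounds(1)[OF _ _ Suc] assms by simp
  also have "\<dots> \<le> hit p (Suc j) i"
    using convex_combination_bounds(2)[OF _ _ Suc] assms by (cases i) auto
  finally show ?case .
qed

text \<open>Raising \<open>p i\<close> moves weight from \<open>hit p j (Suc i)\<close> to the
  larger \<open>hit p j i\<close>. The comparison is confined to indices below \<open>k\<close>
  because \<open>innovation\<close> is 0 from \<open>k\<close> on.\<close>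

lemma hit_mono:
  assumes "\<And>i. i < k \<Longrightarrow> p i \<le> p' i" "\<And>i. 0 \<le> p i \<and> p i \<le> 1" "\<And>i. 0 \<le> p' i \<and> p' i \<le> 1" "i \<le> k"
  shows "hit p j i \<le> hit p' j i"
  using \<open>i \<le> k\<close>
proof (induction j arbitrary: i)
  case 0 show ?case by (cases i) auto
next
  case (Suc j)
  show ?case
  proof (cases i)
    case [simp]: (Suc i')
    have "hit p (Suc j) i \<le> p i' * hit p' j i' + (1 - p i') * hit p' j i"
      using Suc.IH[of i] Suc.IH[of i'] Suc.prems assms(2) by (auto intro!: add_mono mult_left_mono)
    also have "\<dots> = hit p' j i + p i' * (hit p' j i' - hit p' j i)" by (simp add: algebra_simps)
    also have "\<dots> \<le> hit p' j i + p' i' * (hit p' j i' - hit p' j i)"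
      using hit_antimono_Suc[of p' j i', OF assms(3)] assms(1)[of i'] Suc.prems
      by (intro add_left_mono mult_right_mono) auto
    also have "\<dots> = hit p' (Suc j) i" by (simp add: algebra_simps)
    finally show ?thesis .
  qed auto
qed

text \<open>\<open>p ^ i\<close> is the probability that the first \<open>i\<close> steps all
  succeed. The bound keeps the denominators positive.\<close>

lemma hit_ge_power:
  assumes "0 \<le> p" "p \<le> 1" "i \<le> j"
  shows "p ^ i \<le> hit (\<lambda>_. p) j i"
  using \<open>i \<le> j\<close>
proof (induction j arbitrary: i)
  case (Suc j)
  show ?case
  proof (cases i)
    case [simp]: (Suc i')
    have "0 \<le> hit (\<lambda>_. p) j' i" for j' i
      using assms by (induction "\<lambda>_::nat. p" j' i rule: hit.induct) auto
    then have "p * hit (\<lambda>_. p) j i' \<le> hit (\<lambda>_. p) (Suc j) i" using assms by simp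
    moreover have "p * p ^ i' \<le> p * hit (\<lambda>_. p) j i'"
      using Suc.IH[of i'] Suc.prems assms by (intro mult_left_mono) auto
    ultimately show ?thesis by simp
  qed auto
qed auto

lemma hit_le_1: "(\<And>i. 0 \<le> p i \<and> p i \<le> 1) \<Longrightarrow> hit p j i \<le> 1"
  by (induction i) (auto intro: order_trans[OF hit_antimono_Suc])

section \<open>Sums of geometric variables as hitting times, and the closed form of the
  bounds\<close>

lemma geometric_sum_pmf_Suc:
  assumes p: "p \<in> {0<..1}"
  shows "geometric_sum_pmf (Suc r) p =
    bernoulli_pmf p \<bind> (\<lambda>b. map_pmf Suc (geometric_sum_pmf (if b then r else Suc r) p))"
proof -
  have *: "geometric_sum_pmf (Suc r) p =
      geometric_pmf p \<bind> (\<lambda>x. geometric_sum_pmf r p \<bind> (\<lambda>y. return_pmf (Suc x + y)))"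
    by (simp add: geometric_sum_pmf_def map_pmf_def bind_assoc_pmf bind_return_pmf)
  also have "\<dots> = bernoulli_pmf p \<bind> (\<lambda>b.
      if b then map_pmf Suc (geometric_sum_pmf r p)
      else map_pmf Suc (geometric_pmf p \<bind> (\<lambda>x. geometric_sum_pmf r p \<bind> (\<lambda>y. return_pmf (Suc x + y)))))"
    by (subst geometric_bind_pmf_unfold[OF p])
       (auto simp: map_pmf_def bind_assoc_pmf bind_return_pmf intro!: bind_pmf_cong)
  also have "\<dots> = bernoulli_pmf p \<bind> (\<lambda>b. map_pmf Suc (geometric_sum_pmf (if b then r else Suc r) p))"
    unfolding *[symmetric] by (intro bind_pmf_cong refl) auto
  finally show ?thesis .
qed

text \<open>The sum is unfolded at its first trial: a success completes one summand, after a failure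
  the geometric variable starts afresh. \<open>hit\<close> is unfolded at the last step, but for a
  constant success probability the two recursions have the same form.\<close>

lemma geometric_sum_cdf_eq_hit:
  assumes p: "0 < p" "p \<le> 1"
  shows "geometric_sum_cdf r p j = hit (\<lambda>_. p) j r"
proof (induction "\<lambda>_::nat. p" j r rule: hit.induct)
  case (1 j) then show ?case by (simp add: geometric_sum_cdf_def geometric_sum_pmf_def indicator_def)
next
  have bern: "measure_pmf.prob (geometric_sum_pmf (Suc i) p) A =
      p * measure_pmf.prob (geometric_sum_pmf i p) (Suc -` A)
      + (1 - p) * measure_pmf.prob (geometric_sum_pmf (Suc i) p) (Suc -` A)" for i A
  proof -
    have "ennreal (measure_pmf.prob (geometric_sum_pmf (Suc i) p) A) = ennreal (p * measure_pmf.prob (geometric_sum_pmf i p) (Suc -` A)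
      + (1 - p) * measure_pmf.prob (geometric_sum_pmf (Suc i) p) (Suc -` A))"
      using p by (subst geometric_sum_pmf_Suc)
        (auto simp: measure_pmf.emeasure_eq_measure[symmetric] ennreal_plus ennreal_mult mult.commute)
    then show ?thesis using p by (subst (asm) ennreal_inj) auto
  qed
  {
    case (2 i)
    have "Suc -` {..0} = {}" by auto
    then show ?case using bern[of i "{..0}"] by (simp add: geometric_sum_cdf_def)
  next
    case (3 j i)
    have "Suc -` {..Suc j} = {..j}" by auto
    then show ?case using bern[of i "{..Suc j}"] 3 by (simp add: geometric_sum_cdf_def)
  }
qed

text \<open>The difference is the probability of exactly \<open>i\<close> successes in
  \<open>j\<close> trials, and the recursion of \<open>hit\<close> becomes Pascal's rule.\<close>

lemma hit_diff_binomial: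
  "hit (\<lambda>_. p) j i - hit (\<lambda>_. p) j (Suc i) = real (j choose i) * p ^ i * (1 - p) ^ (j - i)"
proof (induction j arbitrary: i)
  case 0 show ?case by (cases i) auto
next
  case (Suc j)
  show ?case
  proof (cases i)
    case 0
    have "hit (\<lambda>_. p) (Suc j) 0 - hit (\<lambda>_. p) (Suc j) (Suc 0) = (1 - p) * (hit (\<lambda>_. p) j 0 - hit (\<lambda>_. p) j (Suc 0))"
      by (simp add: algebra_simps)
    then show ?thesis using Suc[of 0] 0 by simp
  next
    case [simp]: (Suc i')
    have "hit (\<lambda>_. p) (Suc j) i - hit (\<lambda>_. p) (Suc j) (Suc i)
        = p * (hit (\<lambda>_. p) j i' - hit (\<lambda>_. p) j i) + (1 - p) * (hit (\<lambda>_. p) j i - hit (\<lambda>_. p) j (Suc i))"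
      by (simp add: algebra_simps)
    also have "\<dots> = p * (real (j choose i') * p ^ i' * (1 - p) ^ (j - i'))
        + (1 - p) * (real (j choose i) * p ^ i * (1 - p) ^ (j - i))"
      using Suc.IH[of i'] Suc.IH[of i] by simp
    also have "(1 - p) * (real (j choose i) * p ^ i * (1 - p) ^ (j - i))
        = real (j choose i) * p ^ i * (1 - p) ^ (j - i')"
    \<comment> \<open>For \<open>i > j\<close> the truncated exponents disagree, but the binomial
      coefficient is 0.\<close>
    proof (cases "i \<le> j")
      case True
      then have "j - i' = Suc (j - i)" by simp
      then show ?thesis by simp
    qed simp
    finally show ?thesis by (simp add: algebra_simps)
  qed
qed

text \<open>The size-biasing identity in cumulative form. Each step of the induction adds one of its
  terms, which rests on \<open>(n + 1) * (n choose i) = k * (n + 1 choose k)\<close> with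
  \<open>k = i + 1\<close>.\<close>

lemma sum_hit:
  assumes "0 < k"
  shows "p * (real n * hit (\<lambda>_. p) n k - (\<Sum>j<n. hit (\<lambda>_. p) j k)) = real k * hit (\<lambda>_. p) (Suc n) (Suc k)"
proof (induction n)
  case 0 then show ?case using assms by (cases k) auto
next
  case (Suc n)
  obtain i where k: "k = Suc i" using assms by (cases k) auto
  let ?h = "hit (\<lambda>_. p)"
  have "hit (\<lambda>_. p) (Suc n) k - hit (\<lambda>_. p) n k = p * (hit (\<lambda>_. p) n i - hit (\<lambda>_. p) n k)"
    by (simp add: k algebra_simps)
  then have "real (Suc n) * (?h (Suc n) k - ?h n k) = p * (real (Suc n) * real (n choose i) * p ^ i * (1 - p) ^ (n - i))"
    by (simp only: k hit_diff_binomial mult_ac)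
  also have "real (Suc n) * real (n choose i) = real k * real (Suc n choose k)"
    using Suc_times_binomial[of i n] by (simp only: k of_nat_mult[symmetric])
  also have "p * (real k * real (Suc n choose k) * p ^ i * (1 - p) ^ (n - i)) = real k * (?h (Suc n) k - ?h (Suc n) (Suc k))"
    unfolding hit_diff_binomial by (simp add: k)
  finally have "real (Suc n) * (?h (Suc n) k - ?h n k) = real k * (?h (Suc n) k - ?h (Suc n) (Suc k))" .
  then have "p * (real (Suc n) * (?h (Suc n) k - ?h n k)) = real k * (p * (?h (Suc n) k - ?h (Suc n) (Suc k)))"
    by (simp only: mult_ac)
  also have "p * (?h (Suc n) k - ?h (Suc n) (Suc k)) = ?h (Suc (Suc n)) (Suc k) - ?h (Suc n) (Suc k)"
    by (simp only: hit.simps(3)[of _ "Suc n" k]) (simp add: algebra_simps del: hit.simps)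
  finally show ?case using Suc by (simp add: algebra_simps del: hit.simps)
qed

text \<open>Each bound is thus the average age produced by a counter with constant success
  probability, a form that can be compared with the age of an actual scheme.\<close>

lemma age_bound_eq:
  assumes p: "0 < p" "p \<le> 1" and k: "0 < k" "k \<le> n"
  shows "age_bound p k t0 n =
    real n / 2 - 1 + frac (- t0) + (\<Sum>j<n. 1 - hit (\<lambda>_. p) j k) / hit (\<lambda>_. p) n k"
proof -
  have pos: "0 < hit (\<lambda>_. p) n k"
    using hit_ge_power[of p k n] p k zero_less_power[of p k] by linarith
  have eq: "2 * real k * hit (\<lambda>_. p) (n + 1) (k + 1) = 2 * (p * (real n * hit (\<lambda>_. p) n k - (\<Sum>j<n. hit (\<lambda>_. p) j k)))"
    using sum_hit[OF k(1), of p n] by (simp del: hit.simps)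
  show ?thesis
    using p pos unfolding age_bound_def geometric_sum_cdf_eq_hit[OF p] eq
    by (simp add: sum_subtractf field_simps del: hit.simps)
qed


section \<open>Independent blocks\<close>

text \<open>The version for whole families. It passes from single coordinates to pairs of an erasure
  and a column, and from channel uses to blocks.\<close>

lemma (in prob_space) indep_vars_regroup:
  fixes W :: "'i \<Rightarrow> 'a \<Rightarrow> 'w::countable"
  assumes W: "indep_vars (\<lambda>_. count_space UNIV) W I"
    and K: "\<And>j. j \<in> L \<Longrightarrow> finite (K j) \<and> K j \<subseteq> I" "disjoint_family_on K L"
    and f: "\<And>j x y. j \<in> L \<Longrightarrow> (\<And>i. i \<in> K j \<Longrightarrow> x i = y i) \<Longrightarrow> f j x = f j y"
  shows "indep_vars (\<lambda>_. count_space UNIV) (\<lambda>j \<omega>. f j (\<lambda>i. W i \<omega>)) L"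
proof -
  have "indep_vars (\<lambda>_. count_space UNIV) (\<lambda>j \<omega>. f j (restrict (\<lambda>i. W i \<omega>) (K j))) L"
  proof (rule indep_vars_compose2[OF indep_vars_restrict[OF W _ K(2)]])
    fix j assume "j \<in> L"
    then show "K j \<subseteq> I" using K(1) by blast
    show "f j \<in> PiM (K j) (\<lambda>_. count_space UNIV) \<rightarrow>\<^sub>M count_space UNIV"
      using K(1)[OF \<open>j \<in> L\<close>] by (simp add: count_space_PiM_finite)
  qed
  moreover have "f j (restrict x (K j)) = f j x" if "j \<in> L" for j x
    by (rule f[OF that]) simp
  ultimately show ?thesis
    by (simp cong: indep_vars_cong)
qed

text \<open>The joint law is the product law, so by Fubini \<open>X\<close> may be frozen at
  \<open>\<omega>\<close> while \<open>Y\<close> is evaluated at a fresh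
  \<open>\<omega>'\<close>.\<close>

lemma (in prob_space) prob_indep_pair:
  fixes X :: "'a \<Rightarrow> 'b::countable" and Y :: "'a \<Rightarrow> 'b"
  assumes XY: "indep_var (count_space UNIV) X (count_space UNIV) Y"
  shows "prob {\<omega> \<in> space M. R (X \<omega>) (Y \<omega>)} = expectation (\<lambda>\<omega>. prob {\<omega>' \<in> space M. R (X \<omega>) (Y \<omega>')})"
proof -
  have [measurable]: "X \<in> M \<rightarrow>\<^sub>M count_space UNIV" "Y \<in> M \<rightarrow>\<^sub>M count_space UNIV"
    using XY by (auto dest: indep_var_rv1 indep_var_rv2)
  let ?S = "count_space UNIV :: 'b measure" and ?T = "count_space UNIV :: 'b measure"
  have ST: "?S \<Otimes>\<^sub>M ?T = count_space UNIV"
    by (subst pair_measure_countable) auto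
  have R: "{(x, y). R x y} \<in> sets (?S \<Otimes>\<^sub>M ?T)"
    unfolding ST by simp
  interpret X: prob_space "distr M ?S X" by (rule prob_space_distr) measurable
  interpret Y: prob_space "distr M ?T Y" by (rule prob_space_distr) measurable
  have "prob {\<omega> \<in> space M. R (X \<omega>) (Y \<omega>)} = measure (distr M (?S \<Otimes>\<^sub>M ?T) (\<lambda>\<omega>. (X \<omega>, Y \<omega>))) {(x, y). R x y}"
    by (subst measure_distr[OF _ R]) (auto intro!: arg_cong[where f=prob])
  also have "distr M (?S \<Otimes>\<^sub>M ?T) (\<lambda>\<omega>. (X \<omega>, Y \<omega>)) = distr M ?S X \<Otimes>\<^sub>M distr M ?T Y"
    using XY unfolding indep_var_distribution_eq by simp
  finally have eq: "prob {\<omega> \<in> space M. R (X \<omega>) (Y \<omega>)} = measure (distr M ?S X \<Otimes>\<^sub>M distr M ?T Y) {(x, y). R x y}" .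
  have "emeasure (distr M ?S X \<Otimes>\<^sub>M distr M ?T Y) {(x, y). R x y}
      = (\<integral>\<^sup>+x. emeasure (distr M ?T Y) (Pair x -` {(x, y). R x y}) \<partial>distr M ?S X)"
  proof (rule Y.emeasure_pair_measure_alt)
    have "sets (distr M ?S X \<Otimes>\<^sub>M distr M ?T Y) = sets (?S \<Otimes>\<^sub>M ?T)"
      by (intro sets_pair_measure_cong) auto
    then show "{(x, y). R x y} \<in> sets (distr M ?S X \<Otimes>\<^sub>M distr M ?T Y)"
      using R by simp
  qed
  also have "\<dots> = (\<integral>\<^sup>+\<omega>. emeasure (distr M ?T Y) {y. R (X \<omega>) y} \<partial>M)"
    by (subst nn_integral_distr) (auto simp: vimage_def)
  also have "\<dots> = (\<integral>\<^sup>+\<omega>. ennreal (prob {\<omega>' \<in> space M. R (X \<omega>) (Y \<omega>')}) \<partial>M)"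
    by (subst emeasure_distr)
       (auto simp: emeasure_eq_measure vimage_def Int_def conj_commute intro!: nn_integral_cong)
  also have "\<dots> = ennreal (expectation (\<lambda>\<omega>. prob {\<omega>' \<in> space M. R (X \<omega>) (Y \<omega>')}))"
  proof (rule nn_integral_eq_integral)
    have "(\<lambda>x. prob {\<omega>' \<in> space M. R x (Y \<omega>')}) \<circ> X \<in> borel_measurable M"
      by (rule measurable_comp[of X M ?S]) auto
    then show "integrable M (\<lambda>\<omega>. prob {\<omega>' \<in> space M. R (X \<omega>) (Y \<omega>')})"
      by (intro integrable_const_bound[of _ 1]) (auto simp: comp_def)
  qed auto
  finally show ?thesis
    unfolding eq by (simp add: measure_def Bochner_Integration.integral_nonneg)
qed

text \<open>One machine for both decoders: the state is the number of received symbols for the ideal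
  one and the span of the received columns for the random code. Inputs are numbered from 1, like the
  positions in a block.\<close>

primrec run :: "('s \<Rightarrow> 'w \<Rightarrow> 's) \<Rightarrow> 's \<Rightarrow> (nat \<Rightarrow> 'w) \<Rightarrow> nat \<Rightarrow> 's" where
  "run u s w 0 = s"
| "run u s w (Suc j) = u (run u s w j) (w (Suc j))"

lemma run_cong: "(\<And>i. i \<in> {1..j} \<Longrightarrow> w i = w' i) \<Longrightarrow> run u s w j = run u s w' j"
  by (induction j) auto

text \<open>The state may carry more than its level \<open>r\<close>, but the probability of a rise
  depends on the state through \<open>r\<close> alone, so the level is the counter of
  \<open>hit\<close>. \<open>legal\<close> singles out states for which this holds, such as the
  subspaces among all sets of vectors. In one step the level can reach \<open>Suc i'\<close> only
  from \<open>i'\<close>.\<close>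

lemma (in prob_space) prob_run:
  fixes W :: "nat \<Rightarrow> 'a \<Rightarrow> 'w::countable" and u :: "'s::countable \<Rightarrow> 'w \<Rightarrow> 's" and r :: "'s \<Rightarrow> nat"
  assumes W: "indep_vars (\<lambda>_. count_space UNIV) W {1..n}"
    and s0: "r s0 = 0" "legal s0"
    and u: "\<And>s w. legal s \<Longrightarrow> legal (u s w) \<and> (r (u s w) = r s \<or> r (u s w) = Suc (r s))"
    and p: "\<And>s i. legal s \<Longrightarrow> i \<in> {1..n} \<Longrightarrow> prob {\<omega> \<in> space M. r (u s (W i \<omega>)) = Suc (r s)} = p (r s)"
    and "j \<le> n"
  shows "prob {\<omega> \<in> space M. i \<le> r (run u s0 (\<lambda>i. W i \<omega>) j)} = hit p j i"
  using \<open>j \<le> n\<close>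
proof (induction j arbitrary: i)
  case 0 then show ?case using s0 by (cases i) (auto simp: prob_space)
next
  case (Suc j)
  show ?case
  proof (cases i)
    case 0 then show ?thesis by (simp add: prob_space)
  next
    case [simp]: (Suc i')
    define X where "X \<omega> = run u s0 (\<lambda>i. W i \<omega>) j" for \<omega>
    \<comment> \<open>The library states independence only for variables of one type, hence the embeddings into pairs.\<close>
    define e1 e2 where "e1 s = (s, undefined :: 'w)" and "e2 w = (undefined :: 's, w)" for s :: 's and w :: 'w
    have ind: "indep_var (count_space UNIV) (\<lambda>\<omega>. e1 (X \<omega>)) (count_space UNIV) (\<lambda>\<omega>. e2 (W (Suc j) \<omega>))"
      unfolding X_def
      by (rule indep_var_disjoint_parts[OF W, of "{1..j}" "{Suc j}" "\<lambda>w. e1 (run u s0 w j)" _ "\<lambda>w. e2 (w (Suc j))"])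
         (use Suc.prems in \<open>auto intro!: arg_cong[where f=e1] run_cong\<close>)
    then have "fst \<circ> (\<lambda>\<omega>. e1 (X \<omega>)) \<in> M \<rightarrow>\<^sub>M count_space UNIV"
      by (intro measurable_comp[of _ M "count_space UNIV"]) (auto dest: indep_var_rv1)
    then have [measurable]: "X \<in> M \<rightarrow>\<^sub>M count_space UNIV"
      by (simp add: comp_def e1_def)
    have legalX: "legal (X \<omega>)" for \<omega>
    proof -
      have "legal (run u s0 w j)" for w by (induction j) (auto simp: s0 u)
      then show ?thesis by (simp add: X_def)
    qed
    let ?I = "\<lambda>m. indicat_real {\<omega> \<in> space M. m \<le> r (X \<omega>)}"
    have "prob {\<omega> \<in> space M. i \<le> r (run u s0 (\<lambda>i. W i \<omega>) (Suc j))}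
        = prob {\<omega> \<in> space M. i \<le> r (u (X \<omega>) (W (Suc j) \<omega>))}"
      by (simp add: X_def)
    also have "\<dots> = expectation (\<lambda>\<omega>. prob {\<omega>' \<in> space M. i \<le> r (u (X \<omega>) (W (Suc j) \<omega>'))})"
      using prob_indep_pair[OF ind, of "\<lambda>x y. i \<le> r (u (fst x) (snd y))"] by (simp add: e1_def e2_def)
    also have "\<dots> = expectation (\<lambda>\<omega>. p i' * ?I i' \<omega> + (1 - p i') * ?I i \<omega>)"
    proof (intro Bochner_Integration.integral_cong refl)
      fix \<omega> assume \<omega>: "\<omega> \<in> space M"
      have u': "r (u (X \<omega>) w) = r (X \<omega>) \<or> r (u (X \<omega>) w) = Suc (r (X \<omega>))" for w
        using u legalX by blast
      consider "i \<le> r (X \<omega>)" | "r (X \<omega>) = i'" | "r (X \<omega>) < i'" by fastforce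
      then show "prob {\<omega>' \<in> space M. i \<le> r (u (X \<omega>) (W (Suc j) \<omega>'))} = p i' * ?I i' \<omega> + (1 - p i') * ?I i \<omega>"
      proof cases
        case 1
        have "i \<le> r (u (X \<omega>) w)" for w using u'[of w] 1 by auto
        then show ?thesis using 1 \<omega> by (simp add: prob_space)
      next
        case 2
        have "(i \<le> r (u (X \<omega>) w)) = (r (u (X \<omega>) w) = Suc (r (X \<omega>)))" for w using u'[of w] 2 by auto
        then show ?thesis using 2 \<omega> p[OF legalX[of \<omega>], of "Suc j"] Suc.prems by simp
      next
        case 3
        have "\<not> i \<le> r (u (X \<omega>) w)" for w using u'[of w] 3 by auto
        then show ?thesis using 3 \<omega> by simp
      qed
    qed
    also have "\<dots> = p i' * prob {\<omega> \<in> space M. i' \<le> r (X \<omega>)} + (1 - p i') * prob {\<omega> \<in> space M. i \<le> r (X \<omega>)}"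
    proof -
      have "integrable M (?I m)" for m by (intro integrable_real_indicator) (auto simp: emeasure_eq_measure)
      then show ?thesis by simp
    qed
    finally show ?thesis using Suc.IH Suc.prems by (simp add: X_def)
  qed
qed

text \<open>\<open>Suc n\<close> marks a failure within the block. The cap makes the value depend on
  \<open>Q\<close> up to \<open>n\<close> only, hence on the channel uses of a single block.\<close>

definition first_hit :: "nat \<Rightarrow> (nat \<Rightarrow> bool) \<Rightarrow> nat" where
  "first_hit n Q = (if \<exists>j\<le>n. Q j then LEAST j. Q j else Suc n)"

lemma first_hit_le_iff:
  assumes "\<And>i j. i \<le> j \<Longrightarrow> Q i \<Longrightarrow> Q j" "j \<le> n"
  shows "first_hit n Q \<le> j \<longleftrightarrow> Q j"
proof (cases "\<exists>j\<le>n. Q j")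
  case True
  then have "Q (LEAST j. Q j)" using LeastI_ex[of Q] by auto
  then show ?thesis using True assms Least_le[of Q j] by (auto simp: first_hit_def)
qed (use assms in \<open>auto simp: first_hit_def\<close>)

lemma first_hit_cong: "(\<And>j. j \<le> n \<Longrightarrow> Q j = Q' j) \<Longrightarrow> first_hit n Q = first_hit n Q'"
proof -
  assume eq: "\<And>j. j \<le> n \<Longrightarrow> Q j = Q' j"
  show ?thesis
  proof (cases "\<exists>j\<le>n. Q j")
    case True
    then have ex: "\<exists>j\<le>n. Q j" "\<exists>j\<le>n. Q' j" using eq by auto
    have "(LEAST j. Q j) = (LEAST j. Q' j)"
    proof (rule Least_equality)
      obtain j where j: "j \<le> n" "Q' j" using ex by auto
      then have "(LEAST j. Q' j) \<le> n" using Least_le[of Q' j] by linarith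
      then show "Q (LEAST j. Q' j)" using eq LeastI[of Q' j] j by auto
      fix y assume "Q y"
      show "(LEAST j. Q' j) \<le> y"
        using eq[of y] \<open>Q y\<close> Least_le[of Q' y] \<open>(LEAST j. Q' j) \<le> n\<close> by (cases "y \<le> n") auto
    qed
    then show ?thesis using ex by (simp add: first_hit_def)
  next
    case False
    then show ?thesis using eq by (auto simp: first_hit_def)
  qed
qed

text \<open>Different blocks read disjoint inputs, so their decoding positions are independent, and
  \<open>prob_run\<close> supplies the common distribution function
  \<open>hit p j k\<close>.\<close>

lemma (in prob_space)
  fixes W :: "nat \<times> nat \<Rightarrow> 'a \<Rightarrow> 'w::countable" and u :: "'s::countable \<Rightarrow> 'w \<Rightarrow> 's" and r :: "'s \<Rightarrow> nat"
  assumes W: "indep_vars (\<lambda>_. count_space UNIV) W (UNIV \<times> {1..n})"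
    and s0: "r s0 = 0" "legal s0"
    and u: "\<And>s w. legal s \<Longrightarrow> legal (u s w) \<and> (r (u s w) = r s \<or> r (u s w) = Suc (r s))"
    and p: "\<And>s l i. legal s \<Longrightarrow> i \<in> {1..n} \<Longrightarrow> prob {\<omega> \<in> space M. r (u s (W (l, i) \<omega>)) = Suc (r s)} = p (r s)"
    and pos: "0 < hit p n k"
  defines "N \<equiv> \<lambda>\<omega> l. first_hit n (\<lambda>j. k \<le> r (run u s0 (\<lambda>i. W (l, i) \<omega>) j))"
  shows block_gap_sublinear: "AE \<omega> in M. (\<lambda>L. real (gap n (N \<omega>) L) / real L) \<longlonglongrightarrow> 0"
    and block_gap_average: "AE \<omega> in M. (\<lambda>L. (\<Sum>l<L. real (gap n (N \<omega>) l) * real (min (N \<omega> l) n)) / real L)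
                        \<longlonglongrightarrow> (\<Sum>j<n. 1 - hit p j k) / hit p n k"
proof -
  have mono: "r (run u s0 w i) \<le> r (run u s0 w j)" if "i \<le> j" for w i j
  proof -
    have iv: "legal (run u s0 w j)" for j by (induction j) (auto simp: s0 u)
    show ?thesis
      by (rule lift_Suc_mono_le[OF _ that]) (use u[OF iv] in \<open>metis run.simps(2) le_Suc_eq order_refl\<close>)
  qed
  have ind: "indep_vars (\<lambda>_. count_space UNIV) (\<lambda>l \<omega>. N \<omega> l) UNIV"
    unfolding N_def
    by (rule indep_vars_regroup[OF W, where K="\<lambda>l. {l} \<times> {1..n}"
          and f="\<lambda>l x. first_hit n (\<lambda>j. k \<le> r (run u s0 (\<lambda>i. x (l, i)) j))"])
       (auto simp: disjoint_family_on_def intro!: first_hit_cong arg_cong[where f="\<lambda>s. k \<le> r s"] run_cong)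
  have F: "prob {\<omega> \<in> space M. N \<omega> l \<le> j} = hit p j k" if "j \<le> n" for l j
  proof -
    have Wl: "indep_vars (\<lambda>_. count_space UNIV) (\<lambda>i. W (l, i)) {1..n}"
      by (rule indep_vars_regroup[OF W, where K="\<lambda>i. {(l, i)}" and f="\<lambda>i x. x (l, i)"])
         (auto simp: disjoint_family_on_def)
    have "N \<omega> l \<le> j \<longleftrightarrow> k \<le> r (run u s0 (\<lambda>i. W (l, i) \<omega>) j)" for \<omega>
      unfolding N_def by (rule first_hit_le_iff[OF _ that]) (blast intro: order_trans mono)
    then show ?thesis
      using prob_run[of "\<lambda>i. W (l, i)" n r s0 legal u p j k, OF Wl s0 u p that] by simp
  qed
  show "AE \<omega> in M. (\<lambda>L. real (gap n (N \<omega>) L) / real L) \<longlonglongrightarrow> 0"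
    using gap_sublinear[OF ind F pos] by simp
  show "AE \<omega> in M. (\<lambda>L. (\<Sum>l<L. real (gap n (N \<omega>) l) * real (min (N \<omega> l) n)) / real L)
      \<longlonglongrightarrow> (\<Sum>j<n. 1 - hit p j k) / hit p n k"
    using gap_average[OF ind F pos] by simp
qed


section \<open>The erasure and column spaces\<close>

lemma indep_vars_PiM_components:
  fixes p :: "'i \<Rightarrow> 'b pmf"
  shows "prob_space.indep_vars (PiM UNIV (\<lambda>i. measure_pmf (p i))) (\<lambda>_. count_space UNIV) (\<lambda>i \<omega>. \<omega> i) UNIV"
proof -
  let ?P = "PiM UNIV (\<lambda>i. measure_pmf (p i))"
  interpret prob_space ?P by (intro prob_space_PiM prob_space_measure_pmf)
  have c: "distr ?P (measure_pmf (p i)) (\<lambda>x. x i) = measure_pmf (p i)" for i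
    by (rule distr_PiM_component) (auto intro: prob_space_measure_pmf)
  have "indep_vars (\<lambda>i. measure_pmf (p i)) (\<lambda>i \<omega>. \<omega> i) UNIV"
  proof (subst indep_vars_iff_distr_eq_PiM)
    have "distr ?P ?P (\<lambda>x. \<lambda>i\<in>UNIV. x i) = ?P" by (simp add: restrict_def distr_id)
    also have "\<dots> = PiM UNIV (\<lambda>i. distr ?P (measure_pmf (p i)) (\<lambda>x. x i))"
      by (simp only: c)
    finally show "distr ?P ?P (\<lambda>x. \<lambda>i\<in>UNIV. x i) = PiM UNIV (\<lambda>i. distr ?P (measure_pmf (p i)) (\<lambda>x. x i))" .
  qed auto
  then show ?thesis
    by (rule indep_vars_compose2[where Y="\<lambda>_ x. x"]) auto
qed

lemma sets_PiM_component:
  fixes p :: "'i \<Rightarrow> 'b pmf"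
  shows "{\<omega> \<in> space (PiM UNIV (\<lambda>i. measure_pmf (p i))). \<omega> i \<in> A} \<in> sets (PiM UNIV (\<lambda>i. measure_pmf (p i)))"
  using measurable_sets[OF measurable_component_singleton[of i UNIV "\<lambda>i. measure_pmf (p i)"], of A]
  by (simp add: vimage_def Int_def conj_commute)

lemma measure_PiM_component:
  fixes p :: "'i \<Rightarrow> 'b pmf"
  shows "measure (PiM UNIV (\<lambda>i. measure_pmf (p i))) {\<omega> \<in> space (PiM UNIV (\<lambda>i. measure_pmf (p i))). \<omega> i \<in> A} = measure_pmf.prob (p i) A"
proof -
  let ?P = "PiM UNIV (\<lambda>i. measure_pmf (p i))"
  have "measure_pmf.prob (p i) A = measure (distr ?P (measure_pmf (p i)) (\<lambda>\<omega>. \<omega> i)) A"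
    by (subst distr_PiM_component) (auto intro: prob_space_measure_pmf)
  also have "\<dots> = measure ?P ((\<lambda>\<omega>. \<omega> i) -` A \<inter> space ?P)"
    by (rule measure_distr) auto
  finally show ?thesis by (simp add: vimage_def Int_def conj_commute)
qed

text \<open>Erasures and columns have different index and value types, so both are tagged with
  \<open>Inl\<close> and \<open>Inr\<close> to form a single independent family. Finite
  intersections of events are rectangles, on which the product measure factors.\<close>

lemma indep_vars_pair_measure:
  assumes M1: "prob_space M1" and M2: "prob_space M2"
    and X: "prob_space.indep_vars M1 (\<lambda>_. count_space UNIV) X (UNIV :: 'i set)"
    and Y: "prob_space.indep_vars M2 (\<lambda>_. count_space UNIV) Y (UNIV :: 'j set)"
  shows "prob_space.indep_vars (M1 \<Otimes>\<^sub>M M2) (\<lambda>_. count_space UNIV)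
    (case_sum (\<lambda>i \<omega>. Inl (X i (fst \<omega>))) (\<lambda>j \<omega>. Inr (Y j (snd \<omega>)))) UNIV"
proof -
  interpret M1: prob_space M1 by fact
  interpret M2: prob_space M2 by fact
  interpret P: pair_prob_space M1 M2 ..
  let ?Z = "case_sum (\<lambda>i \<omega>. Inl (X i (fst \<omega>))) (\<lambda>j \<omega>. Inr (Y j (snd \<omega>)))"
  let ?P = "M1 \<Otimes>\<^sub>M M2"
  have [measurable]: "X i \<in> M1 \<rightarrow>\<^sub>M count_space UNIV" for i
    using X by (auto simp: M1.indep_vars_def)
  have [measurable]: "Y j \<in> M2 \<rightarrow>\<^sub>M count_space UNIV" for j
    using Y by (auto simp: M2.indep_vars_def)
  have Z: "?Z i \<in> ?P \<rightarrow>\<^sub>M count_space UNIV" for i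
  proof (cases i)
    case [simp]: (Inl a)
    have "(\<lambda>x. Inl (X a x)) \<in> M1 \<rightarrow>\<^sub>M count_space UNIV"
      by (rule measurable_compose[of "X a" _ "count_space UNIV"]) auto
    then show ?thesis using measurable_compose[OF measurable_fst] by simp
  next
    case [simp]: (Inr a)
    have "(\<lambda>x. Inr (Y a x)) \<in> M2 \<rightarrow>\<^sub>M count_space UNIV"
      by (rule measurable_compose[of "Y a" _ "count_space UNIV"]) auto
    then show ?thesis using measurable_compose[OF measurable_snd] by simp
  qed
  show ?thesis
    unfolding P.indep_vars_def2
  proof (intro conjI ballI Z P.indep_setsI)
    fix i show "{?Z i -` A \<inter> space ?P |A. A \<in> sets (count_space UNIV)} \<subseteq> P.events"
      using measurable_sets[OF Z[of i]] by auto
  next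
    fix A J assume J: "J \<noteq> {}" "finite J" and A: "\<forall>j\<in>J. A j \<in> {?Z j -` A \<inter> space ?P |A. A \<in> sets (count_space UNIV)}"
    then obtain C where C: "\<And>j. j \<in> J \<Longrightarrow> A j = ?Z j -` C j \<inter> space ?P"
      by simp metis
    define J1 J2 where "J1 = Inl -` J" and "J2 = Inr -` J"
    have JJ: "J = J1 <+> J2"
      by (auto simp: J1_def J2_def Plus_def image_iff) (metis old.sum.exhaust)
    have fin: "finite J1" "finite J2"
      using J by (auto simp: J1_def J2_def intro!: finite_vimageI)
    define B1 where "B1 i = X i -` (Inl -` C (Inl i)) \<inter> space M1" for i
    define B2 where "B2 j = Y j -` (Inr -` C (Inr j)) \<inter> space M2" for j
    have B1 [measurable]: "B1 i \<in> sets M1" for i unfolding B1_def by measurable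
    have B2 [measurable]: "B2 i \<in> sets M2" for i unfolding B2_def by measurable
    have times: "P.prob (S \<times> T) = M1.prob S * M2.prob T" if "S \<in> sets M1" "T \<in> sets M2" for S T
      using M2.emeasure_pair_measure_Times[OF that]
      by (simp add: measure_def enn2real_mult)
    have A1: "A (Inl i) = B1 i \<times> space M2" if "i \<in> J1" for i
      using C[of "Inl i"] that by (auto simp: B1_def J1_def space_pair_measure)
    have A2: "A (Inr i) = space M1 \<times> B2 i" if "i \<in> J2" for i
      using C[of "Inr i"] that by (auto simp: B2_def J2_def space_pair_measure)
    \<comment> \<open>Intersecting with \<open>space M1\<close> covers an empty \<open>J1\<close>,
      where the bare intersection would be \<open>UNIV\<close>; likewise for \<open>J2\<close>
      below.\<close>
    have pI1: "M1.prob (space M1 \<inter> (\<Inter>i\<in>J1. B1 i)) = (\<Prod>i\<in>J1. M1.prob (B1 i))"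
    proof (cases "J1 = {}")
      case False
      have "(\<Inter>i\<in>J1. B1 i) = space M1 \<inter> (\<Inter>i\<in>J1. B1 i)" using False by (auto simp: B1_def)
      then show ?thesis
        using M1.indep_varsD_finite[OF M1.indep_vars_subset[OF X], of J1 "\<lambda>i. Inl -` C (Inl i)"] False fin
        by (simp add: B1_def)
    qed (simp add: M1.prob_space)
    have pI2: "M2.prob (space M2 \<inter> (\<Inter>i\<in>J2. B2 i)) = (\<Prod>i\<in>J2. M2.prob (B2 i))"
    proof (cases "J2 = {}")
      case False
      have "(\<Inter>i\<in>J2. B2 i) = space M2 \<inter> (\<Inter>i\<in>J2. B2 i)" using False by (auto simp: B2_def)
      then show ?thesis
        using M2.indep_varsD_finite[OF M2.indep_vars_subset[OF Y], of J2 "\<lambda>i. Inr -` C (Inr i)"] False fin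
        by (simp add: B2_def)
    qed (simp add: M2.prob_space)
    have "(\<Inter>j\<in>J. A j) = (space M1 \<inter> (\<Inter>i\<in>J1. B1 i)) \<times> (space M2 \<inter> (\<Inter>i\<in>J2. B2 i))"
    proof -
      have e1: "(\<Inter>j\<in>J. A j) = space ?P \<inter> (\<Inter>j\<in>J. A j)" using J C by blast
      have "(\<Inter>j\<in>J. A j) = (\<Inter>i\<in>J1. A (Inl i)) \<inter> (\<Inter>i\<in>J2. A (Inr i))"
        unfolding JJ by (auto simp: Plus_def)
      also have "\<dots> = (\<Inter>i\<in>J1. B1 i \<times> space M2) \<inter> (\<Inter>i\<in>J2. space M1 \<times> B2 i)"
        by (simp add: A1 A2)
      finally have e2: "(\<Inter>j\<in>J. A j) = (\<Inter>i\<in>J1. B1 i \<times> space M2) \<inter> (\<Inter>i\<in>J2. space M1 \<times> B2 i)" .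
      show ?thesis by (subst e1, subst e2) (auto simp: space_pair_measure)
    qed
    also have "P.prob \<dots> = (\<Prod>i\<in>J1. M1.prob (B1 i)) * (\<Prod>i\<in>J2. M2.prob (B2 i))"
      using fin by (subst times) (auto simp: pI1 pI2)
    also have "\<dots> = (\<Prod>i\<in>J1. P.prob (A (Inl i))) * (\<Prod>i\<in>J2. P.prob (A (Inr i)))"
      by (simp add: A1 A2 times M1.prob_space M2.prob_space)
    also have "\<dots> = (\<Prod>j\<in>J. P.prob (A j))"
      unfolding JJ using fin by (simp add: prod.Plus)
    finally show "P.prob (\<Inter>j\<in>J. A j) = (\<Prod>j\<in>J. P.prob (A j))" .
  qed
qed

lemma prob_space_erasure_space: "prob_space (erasure_space \<epsilon>)"
  unfolding erasure_space_def by (intro prob_space_PiM prob_space_measure_pmf)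

lemma prob_space_column_space: "prob_space column_space"
  unfolding column_space_def by (intro prob_space_PiM prob_space_measure_pmf)

section \<open>Channel uses grouped into blocks, and the ideal decoder\<close>

lemma block_position_inj:
  fixes n :: nat
  assumes "l * n + i = l' * n + i'" "i \<in> {1..n}" "i' \<in> {1..n}"
  shows "l = l' \<and> i = i'"
proof -
  have *: "(l * n + i - 1) div n = l" if i: "i \<in> {1..n}" for l i
  proof -
    obtain m where "i = Suc m" "m < n" using i by (cases i) auto
    then show ?thesis by simp
  qed
  then have "l = l'" using assms by metis
  then show ?thesis using assms(1) by simp
qed

lemma received_Suc:
  "received n e (Suc l) (Suc j) = (if e (l * n + Suc j) then received n e (Suc l) j else insert (Suc j) (received n e (Suc l) j))"
  by (auto simp: received_def le_Suc_eq)

lemma received_0 [simp]: "received n e l 0 = {}"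
  by (simp add: received_def)

lemma finite_received [simp]: "finite (received n e l j)"
  by (simp add: received_def)

text \<open>The benchmark for the lower bounds: a decoder for which any \<open>k\<close> received
  symbols suffice. Its state is the number of received symbols, which rises with probability
  \<open>1 - \<epsilon>\<close>.\<close>

lemma
  assumes \<epsilon>: "0 \<le> \<epsilon>" "\<epsilon> < 1" and k: "k \<le> n"
  defines "N \<equiv> \<lambda>e l. first_hit n (\<lambda>j. k \<le> card (received n e (Suc l) j))"
  shows ideal_gap_sublinear: "AE e in erasure_space \<epsilon>. (\<lambda>L. real (gap n (N e) L) / real L) \<longlonglongrightarrow> 0"
    and ideal_gap_average: "AE e in erasure_space \<epsilon>.
      (\<lambda>L. (\<Sum>l<L. real (gap n (N e) l) * real (min (N e l) n)) / real L)
        \<longlonglongrightarrow> (\<Sum>j<n. 1 - hit (\<lambda>_. 1 - \<epsilon>) j k) / hit (\<lambda>_. 1 - \<epsilon>) n k"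
proof -
  interpret prob_space "erasure_space \<epsilon>" by (rule prob_space_erasure_space)
  define u where "u s b = (if b then Suc s else s)" for s b
  \<comment> \<open>\<open>l\<close> counts blocks from 0, so channel use \<open>l * n + i\<close>
    is position \<open>i\<close> of the block called \<open>Suc l\<close> in
    \<open>received\<close>.\<close>
  define W where "W = (\<lambda>(l, i) (e :: nat \<Rightarrow> bool). \<not> e (l * n + i))"
  have W: "indep_vars (\<lambda>_. count_space UNIV) W (UNIV \<times> {1..n})"
    unfolding W_def case_prod_unfold
    by (rule indep_vars_regroup[where W="\<lambda>i e. e i" and I=UNIV and K="\<lambda>x. {fst x * n + snd x}"
          and f="\<lambda>x e. \<not> e (fst x * n + snd x)"])
       (use indep_vars_PiM_components[of "\<lambda>_. bernoulli_pmf \<epsilon>"] in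
         \<open>auto simp: erasure_space_def disjoint_family_on_def dest: block_position_inj\<close>)
  have run: "run u 0 (\<lambda>i. W (l, i) e) j = card (received n e (Suc l) j)" for l e j
  proof (induction j)
    case (Suc j)
    have "Suc j \<notin> received n e (Suc l) j" by (simp add: received_def)
    then show ?case using Suc by (simp add: received_Suc u_def W_def)
  qed simp
  have p: "prob {\<omega> \<in> space (erasure_space \<epsilon>). u s (W (l, i) \<omega>) = Suc s} = 1 - \<epsilon>" for s l i
  proof -
    have "u s b = Suc s \<longleftrightarrow> b" for b by (simp add: u_def)
    then show ?thesis
      using measure_PiM_component[of "\<lambda>_. bernoulli_pmf \<epsilon>" "l * n + i" "{False}"] \<epsilon>
      by (simp add: W_def erasure_space_def measure_pmf_single)
  qed
  have "0 < (1 - \<epsilon>) ^ k" using \<epsilon> by simp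
  then have pos: "0 < hit (\<lambda>_. 1 - \<epsilon>) n k"
    using hit_ge_power[of "1 - \<epsilon>" k n] \<epsilon> k by linarith
  note * = block_gap_sublinear[OF W, of "\<lambda>s. s" 0 "\<lambda>_. True" u, OF _ _ _ p pos]
    block_gap_average[OF W, of "\<lambda>s. s" 0 "\<lambda>_. True" u, OF _ _ _ p pos]
  show "AE e in erasure_space \<epsilon>. (\<lambda>L. real (gap n (N e) L) / real L) \<longlonglongrightarrow> 0"
    using *(1) unfolding run N_def by (simp add: u_def)
  show "AE e in erasure_space \<epsilon>.
      (\<lambda>L. (\<Sum>l<L. real (gap n (N e) l) * real (min (N e l) n)) / real L)
        \<longlonglongrightarrow> (\<Sum>j<n. 1 - hit (\<lambda>_. 1 - \<epsilon>) j k) / hit (\<lambda>_. 1 - \<epsilon>) n k"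
    using *(2) unfolding run N_def by (simp add: u_def)
qed

section \<open>Counting vectors in subspaces, and the decoding of random columns\<close>

lemma card_span_insert:
  fixes S :: "('q::{field,finite} ^ 'k::finite) set"
  assumes c: "c \<notin> vec.span S"
  shows "card (vec.span (insert c S)) = CARD('q) * card (vec.span S)"
proof -
  let ?f = "\<lambda>(a :: 'q, v). a *s c + v"
  have "vec.span (insert c S) = ?f ` (UNIV \<times> vec.span S)"
  proof (intro set_eqI iffI)
    fix x assume "x \<in> vec.span (insert c S)"
    then obtain a where "x - a *s c \<in> vec.span S" unfolding vec.span_insert by auto
    then have "x = ?f (a, x - a *s c)" "(a, x - a *s c) \<in> UNIV \<times> vec.span S" by auto
    then show "x \<in> ?f ` (UNIV \<times> vec.span S)" by (rule image_eqI)
  next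
    fix x assume "x \<in> ?f ` (UNIV \<times> vec.span S)"
    then obtain a v where "x = a *s c + v" "v \<in> vec.span S" by auto
    then have "x - a *s c \<in> vec.span S" by simp
    then show "x \<in> vec.span (insert c S)" unfolding vec.span_insert by blast
  qed
  moreover have "inj_on ?f (UNIV \<times> vec.span S)"
  proof (rule inj_onI, clarify)
    fix a b v w assume vw: "v \<in> vec.span S" "w \<in> vec.span S" and eq: "a *s c + v = b *s c + w"
    have "a = b"
    proof (rule ccontr)
      assume "a \<noteq> b"
      have "(a - b) *s c = w - v" using eq by (simp add: vec.scale_left_diff_distrib algebra_simps)
      then have "(a - b) *s c \<in> vec.span S" using vw by (simp add: vec.span_diff)
      then have "inverse (a - b) *s ((a - b) *s c) \<in> vec.span S" by (rule vec.span_scale)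
      then show False using c \<open>a \<noteq> b\<close> by (simp del: vector_sub_rdistrib)
    qed
    then show "a = b \<and> v = w" using eq by simp
  qed
  ultimately show ?thesis by (simp add: card_image card_cartesian_product)
qed

lemma card_subspace:
  fixes V :: "('q::{field,finite} ^ 'k::finite) set"
  assumes V: "vec.subspace V"
  shows "card V = CARD('q) ^ vec.dim V"
proof -
  obtain B where B: "B \<subseteq> V" "vec.independent B" "V \<subseteq> vec.span B" "card B = vec.dim V"
    using vec.basis_exists[of V] by metis
  have "card (vec.span B) = CARD('q) ^ card B"
    using finite[of B] B(2)
  proof (induction B rule: finite_induct)
    case (insert x F)
    then have "x \<notin> vec.span F" "vec.independent F" by (auto simp: vec.independent_insert)
    then show ?case using insert by (simp add: card_span_insert)
  qed simp
  moreover have "vec.span B = V"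
    using B V by (intro antisym vec.span_minimal) auto
  ultimately show ?thesis using B by simp
qed

lemma span_insert_span: "vec.span (insert c (vec.span S)) = vec.span (insert c S)"
  unfolding vec.span_insert vec.span_span ..

text \<open>The probability that the next column is received and not in a given subspace of dimension
  \<open>i \<le> k\<close>; beyond \<open>k\<close> it is extended by 0.\<close>

definition innovation :: "nat \<Rightarrow> real \<Rightarrow> nat \<Rightarrow> nat \<Rightarrow> real" where
  "innovation q \<epsilon> k i = (1 - \<epsilon>) * ((real q ^ k - real q ^ min i k) / (real q ^ k - 1))"

lemma
  assumes \<epsilon>: "0 \<le> \<epsilon>" "\<epsilon> < 1" and q: "2 \<le> q" and k: "0 < k"
  shows innovation_prob_pos: "0 < innovation_prob q \<epsilon> k"
    and innovation_prob_le_1: "innovation_prob q \<epsilon> k \<le> 1"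
    and innovation_bounds: "0 \<le> innovation q \<epsilon> k i \<and> innovation q \<epsilon> k i \<le> 1"
    and innovation_prob_le: "i < k \<Longrightarrow> innovation_prob q \<epsilon> k \<le> innovation q \<epsilon> k i"
proof -
  have gt1: "1 < real q ^ k" using q k by (intro one_less_power) auto
  \<comment> \<open>This identifies \<open>innovation_prob\<close> with \<open>innovation\<close> at
    \<open>k - 1\<close>, the smallest innovation probability before completion.\<close>
  have last: "real q ^ (k - 1) * (real q - 1) = real q ^ k - real q ^ (k - 1)"
    using k by (simp add: algebra_simps power_eq_if)
  have pw: "1 \<le> real q ^ i" for i using q by (intro one_le_power) auto
  have "0 < real q ^ (k - 1) * (real q - 1)" using q by simp
  then show pos: "0 < innovation_prob q \<epsilon> k"
    using \<epsilon> gt1 unfolding innovation_prob_def by (intro mult_pos_pos[OF _ divide_pos_pos]) auto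
  have mono: "real q ^ min i k \<le> real q ^ k" for i using q by (intro power_increasing) auto
  show bounds: "0 \<le> innovation q \<epsilon> k i \<and> innovation q \<epsilon> k i \<le> 1" for i
    using \<epsilon> gt1 pw[of "min i k"] mono[of i] unfolding innovation_def
    by (intro conjI mult_nonneg_nonneg divide_nonneg_nonneg mult_le_one) auto
  show le: "innovation_prob q \<epsilon> k \<le> innovation q \<epsilon> k i" if "i < k" for i
  proof -
    have "real q ^ i \<le> real q ^ (k - 1)" using q that by (intro power_increasing) auto
    then show ?thesis
      using \<epsilon> gt1 that unfolding innovation_prob_def innovation_def last
      by (intro mult_left_mono divide_right_mono) auto
  qed
  show "innovation_prob q \<epsilon> k \<le> 1"
    using order_trans[OF le[of 0]] bounds[of 0] k by auto
qed

text \<open>The state is the span of the received columns and its dimension the counter. A received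
  column raises the dimension iff it lies outside the span, and every subspace of dimension
  \<open>i\<close> misses \<open>q ^ k - q ^ i\<close> of the \<open>q ^ k - 1\<close> nonzero
  vectors. The probability of a rise therefore depends on the dimension alone.\<close>

lemma
  fixes \<epsilon> :: real and n :: nat
  assumes \<epsilon>: "0 \<le> \<epsilon>" "\<epsilon> < 1" and k: "k = CARD('k::finite)" "k \<le> n" and q: "q = CARD('q::{field,finite})"
  defines "N \<equiv> \<lambda>e (g :: nat \<times> nat \<Rightarrow> 'q ^ 'k) l. first_hit n (\<lambda>j. determined (\<lambda>i. g (Suc l, i)) (received n e (Suc l) j))"
    and "P \<equiv> erasure_space \<epsilon> \<Otimes>\<^sub>M (column_space :: (nat \<times> nat \<Rightarrow> 'q ^ 'k) measure)"
    and "p \<equiv> innovation q \<epsilon> k"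
  shows random_gap_sublinear: "AE (e, g) in P. (\<lambda>L. real (gap n (N e g) L) / real L) \<longlonglongrightarrow> 0"
    and random_gap_average: "AE (e, g) in P.
      (\<lambda>L. (\<Sum>l<L. real (gap n (N e g) l) * real (min (N e g l) n)) / real L)
        \<longlonglongrightarrow> (\<Sum>j<n. 1 - hit p j k) / hit p n k"
    and random_hit_ge: "hit (\<lambda>_. innovation_prob q \<epsilon> k) j k \<le> hit p j k"
proof -
  let ?E = "erasure_space \<epsilon>" and ?C = "column_space :: (nat \<times> nat \<Rightarrow> 'q ^ 'k) measure"
  interpret E: prob_space ?E by (rule prob_space_erasure_space)
  interpret C: prob_space ?C by (rule prob_space_column_space)
  interpret P: pair_prob_space ?E ?C ..
  have q2: "2 \<le> q"
  proof -
    have "card {0, 1 :: 'q} \<le> CARD('q)" by (intro card_mono) auto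
    then show ?thesis by (simp add: q)
  qed
  have k0: "0 < k" by (simp add: k)
  note ip = innovation_prob_pos[OF \<epsilon> q2 k0] innovation_prob_le_1[OF \<epsilon> q2 k0]
    innovation_bounds[OF \<epsilon> q2 k0] innovation_prob_le[OF \<epsilon> q2 k0]
  show ge: "hit (\<lambda>_. innovation_prob q \<epsilon> k) j k \<le> hit p j k" for j
    unfolding p_def using ip by (intro hit_mono[where k=k]) (auto intro: less_imp_le)
  have "0 < innovation_prob q \<epsilon> k ^ k" using ip(1) by (rule zero_less_power)
  also have "\<dots> \<le> hit (\<lambda>_. innovation_prob q \<epsilon> k) n k"
    by (intro hit_ge_power less_imp_le ip k)
  also note ge
  finally have pos: "0 < hit p n k" .
  define u :: "('q ^ 'k) set \<Rightarrow> bool \<times> ('q ^ 'k) \<Rightarrow> ('q ^ 'k) set" where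
    "u V x = (if fst x then vec.span (insert (snd x) V) else V)" for V x
  define W where "W = (\<lambda>(l, i) (x :: (nat \<Rightarrow> bool) \<times> (nat \<times> nat \<Rightarrow> 'q ^ 'k)). (\<not> fst x (l * n + i), snd x (Suc l, i)))"
  \<comment> \<open>All erasures and columns as one independent family; \<open>W\<close> below
    regroups it into one pair per position.\<close>
  let ?Z = "case_sum (\<lambda>i x. Inl (fst x i)) (\<lambda>j x. Inr (snd x j)) ::
    nat + nat \<times> nat \<Rightarrow> (nat \<Rightarrow> bool) \<times> (nat \<times> nat \<Rightarrow> 'q ^ 'k) \<Rightarrow> bool + ('q ^ 'k)"
  have Z: "P.indep_vars (\<lambda>_. count_space UNIV) ?Z UNIV"
    using indep_vars_pair_measure[OF E.prob_space_axioms C.prob_space_axioms, of "\<lambda>i x. x i" "\<lambda>i x. x i"]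
      indep_vars_PiM_components[of "\<lambda>_. bernoulli_pmf \<epsilon>"]
      indep_vars_PiM_components[of "\<lambda>_. pmf_of_set (UNIV - {0 :: 'q ^ 'k})"]
    by (simp add: erasure_space_def column_space_def)
  have W: "P.indep_vars (\<lambda>_. count_space UNIV) W (UNIV \<times> {1..n})"
  proof -
    have "P.indep_vars (\<lambda>_. count_space UNIV)
        (\<lambda>x \<omega>. (\<lambda>x z. (\<not> projl (z (Inl (fst x * n + snd x))), projr (z (Inr (Suc (fst x), snd x))))) x (\<lambda>i. ?Z i \<omega>)) (UNIV \<times> {1..n})"
      by (rule P.indep_vars_regroup[OF Z, where K="\<lambda>x. {Inl (fst x * n + snd x), Inr (Suc (fst x), snd x)}"])
         (auto simp: disjoint_family_on_def dest: block_position_inj)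
    then show ?thesis by (simp add: W_def case_prod_unfold)
  qed
  have run: "run u {0} (\<lambda>i. W (l, i) (e, g)) j = vec.span ((\<lambda>i. g (Suc l, i)) ` received n e (Suc l) j)" for l e g j
  proof (induction j)
    case (Suc j)
    then show ?case
      by (simp add: received_Suc u_def W_def span_insert_span)
  qed simp
  have dim_u: "vec.dim (u V x) = (if fst x \<and> snd x \<notin> V then Suc (vec.dim V) else vec.dim V)"
    if "vec.subspace V" for V x
  proof -
    have eq: "vec.span V = V" using that by (simp add: vec.span_eq_iff)
    show ?thesis by (simp add: u_def vec.dim_insert[of _ V, unfolded eq])
  qed
  have sub_u: "vec.subspace (u V x)" if "vec.subspace V" for V x
    using that by (simp add: u_def)
  have pr: "P.prob {\<omega> \<in> space (?E \<Otimes>\<^sub>M ?C). vec.dim (u V (W (l, i) \<omega>)) = Suc (vec.dim V)} = p (vec.dim V)"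
    if V: "vec.subspace V" for V l i
  proof -
    \<comment> \<open>The dimension rises iff the symbol is received and its column lies outside
      \<open>V\<close>: a rectangle in the product space.\<close>
    have "{\<omega> \<in> space (?E \<Otimes>\<^sub>M ?C). vec.dim (u V (W (l, i) \<omega>)) = Suc (vec.dim V)}
        = {e \<in> space ?E. e (l * n + i) \<in> {False}} \<times> {g \<in> space ?C. g (Suc l, i) \<in> - V}"
      by (auto simp: dim_u[OF V] W_def space_pair_measure split: if_splits)
    also have "P.prob \<dots> = E.prob {e \<in> space ?E. e (l * n + i) \<in> {False}} * C.prob {g \<in> space ?C. g (Suc l, i) \<in> - V}"
    proof -
      have "{e \<in> space ?E. e (l * n + i) \<in> {False}} \<in> sets ?E"
        unfolding erasure_space_def by (rule sets_PiM_component)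
      moreover have "{g \<in> space ?C. g (Suc l, i) \<in> - V} \<in> sets ?C"
        unfolding column_space_def by (rule sets_PiM_component)
      ultimately show ?thesis
        by (simp only: measure_def C.emeasure_pair_measure_Times enn2real_mult)
    qed
    also have "E.prob {e \<in> space ?E. e (l * n + i) \<in> {False}} = 1 - \<epsilon>"
      using measure_PiM_component[of "\<lambda>_. bernoulli_pmf \<epsilon>" "l * n + i" "{False}"] \<epsilon>
      by (simp add: erasure_space_def measure_pmf_single)
    also have "C.prob {g \<in> space ?C. g (Suc l, i) \<in> - V} = (real q ^ k - real q ^ min (vec.dim V) k) / (real q ^ k - 1)"
    proof -
      have card: "CARD('q ^ 'k) = q ^ k" by (simp add: q k CARD_vec)
      have nz: "(UNIV - {0 :: 'q ^ 'k}) \<noteq> {}"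
      proof -
        have "axis undefined 1 \<in> UNIV - {0 :: 'q ^ 'k}" by simp
        then show ?thesis by blast
      qed
      \<comment> \<open>Since \<open>V\<close> contains 0, excluding the zero column removes nothing
        from the complement of \<open>V\<close>; it only lowers the denominator to
        \<open>q ^ k - 1\<close>.\<close>
      have V0: "0 \<in> V" using V by (simp add: vec.subspace_0)
      have dimV: "vec.dim V \<le> k" unfolding k by (rule dim_subset_UNIV_cart_gen)
      have "C.prob {g \<in> space ?C. g (Suc l, i) \<in> - V} = measure_pmf.prob (pmf_of_set (UNIV - {0 :: 'q ^ 'k})) (- V)"
        using measure_PiM_component[of "\<lambda>_. pmf_of_set (UNIV - {0 :: 'q ^ 'k})" "(Suc l, i)" "- V"]
        by (simp add: column_space_def)
      also have "\<dots> = card ((UNIV - {0}) \<inter> (- V)) / card (UNIV - {0 :: 'q ^ 'k})"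
        by (rule measure_pmf_of_set[OF nz]) simp
      also have "(UNIV - {0}) \<inter> (- V) = UNIV - V" using V0 by auto
      also have "real (card (UNIV - V)) = real q ^ k - real q ^ vec.dim V"
      proof -
        have "card (UNIV - V) = CARD('q ^ 'k) - card V" by (rule card_Diff_subset) auto
        also have "\<dots> = q ^ k - q ^ vec.dim V" by (simp only: card card_subspace[OF V] q)
        finally show ?thesis
          using q2 dimV power_increasing[of "vec.dim V" k q] by (simp add: of_nat_diff)
      qed
      also have "real (card (UNIV - {0 :: 'q ^ 'k})) = real q ^ k - 1"
      proof -
        have "card (UNIV - {0 :: 'q ^ 'k}) = CARD('q ^ 'k) - card {0 :: 'q ^ 'k}"
          by (rule card_Diff_subset) auto
        also have "\<dots> = q ^ k - 1" by (simp only: card card.empty card_insert_disjoint finite.emptyI empty_iff not_False_eq_True)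
        finally show ?thesis using q2 by (simp add: of_nat_diff)
      qed
      finally show ?thesis using dimV by (simp add: min_def)
    qed
    finally show ?thesis by (simp add: p_def innovation_def)
  qed
  have det: "k \<le> vec.dim (run u {0} (\<lambda>i. W (l, i) (e, g)) j) \<longleftrightarrow> determined (\<lambda>i. g (Suc l, i)) (received n e (Suc l) j)" for l e g j
  proof -
    have "determined (\<lambda>i. g (Suc l, i)) (received n e (Suc l) j)
        \<longleftrightarrow> vec.dim ((\<lambda>i. g (Suc l, i)) ` received n e (Suc l) j) = k"
      unfolding determined_iff_span vec.dim_eq_full[symmetric] vec.dimension_def k
      by (metis vec.dim_UNIV vec.dimension_def vec_dim_card)
    also have "\<dots> \<longleftrightarrow> k \<le> vec.dim (run u {0} (\<lambda>i. W (l, i) (e, g)) j)"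
      unfolding run vec.dim_span using dim_subset_UNIV_cart_gen k by (metis le_antisym order_refl)
    finally show ?thesis ..
  qed
  have det': "k \<le> vec.dim (run u {0} (\<lambda>i. W (l, i) x) j)
      \<longleftrightarrow> determined (\<lambda>i. snd x (Suc l, i)) (received n (fst x) (Suc l) j)" for l x j
    using det[of l "fst x" "snd x" j] by simp
  have step: "vec.subspace (u V x) \<and> (vec.dim (u V x) = vec.dim V \<or> vec.dim (u V x) = Suc (vec.dim V))"
    if "vec.subspace V" for V x
    using that by (simp add: sub_u dim_u)
  have d0: "vec.dim {0 :: 'q ^ 'k} = 0" "vec.subspace {0 :: 'q ^ 'k}"
    using vec.dim_span[of "{} :: ('q ^ 'k) set"] by (auto simp: vec.subspace_single_0)
  show "AE (e, g) in P. (\<lambda>L. real (gap n (N e g) L) / real L) \<longlonglongrightarrow> 0"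
    using P.block_gap_sublinear[OF W d0 step pr pos] unfolding P_def N_def
    by (simp add: det' split_beta)
  show "AE (e, g) in P.
      (\<lambda>L. (\<Sum>l<L. real (gap n (N e g) l) * real (min (N e g l) n)) / real L)
        \<longlonglongrightarrow> (\<Sum>j<n. 1 - hit p j k) / hit p n k"
    using P.block_gap_average[OF W d0 step pr pos] unfolding P_def N_def
    by (simp add: det' split_beta)
qed


section \<open>The age of a fixed scheme\<close>

text \<open>From \<open>T\<close> on the integral up to \<open>\<tau>\<close> is monotone, so inside
  a block it lies between its values at the two ends. Nonnegativity is asked only from
  \<open>T\<close> on, because before the first decoding the age \<open>a0 + t\<close> may be
  negative.\<close>

lemma average_of_block_averages:
  fixes f :: "real \<Rightarrow> real" and n :: nat
  assumes n: "0 < n" and int: "\<And>L. f integrable_on {0..real L * real n}"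
    and nonneg: "\<And>t. T \<le> t \<Longrightarrow> 0 \<le> f t"
    and lim: "(\<lambda>L. integral {0..real L * real n} f / (real L * real n)) \<longlonglongrightarrow> \<delta>"
  shows "((\<lambda>\<tau>. 1 / \<tau> * integral {0..\<tau>} f) \<longlongrightarrow> \<delta>) at_top"
proof -
  define I where "I \<tau> = integral {0..\<tau>} f" for \<tau>
  define a where "a L = I (real L * real n) / (real L * real n)" for L
  have a: "a \<longlonglongrightarrow> \<delta>" using lim by (simp add: a_def[abs_def] I_def)
  define m where "m \<tau> = nat \<lfloor>\<tau> / real n\<rfloor>" for \<tau>
  have m: "real (m \<tau>) * real n \<le> \<tau>" "\<tau> \<le> real (Suc (m \<tau>)) * real n" if "0 \<le> \<tau>" for \<tau>
  proof -
    have "real (m \<tau>) = of_int \<lfloor>\<tau> / real n\<rfloor>" using that by (simp add: m_def)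
    then have "real (m \<tau>) \<le> \<tau> / real n" "\<tau> / real n \<le> real (Suc (m \<tau>))"
      using of_int_floor_le[of "\<tau> / real n"] real_of_int_floor_add_one_ge[of "\<tau> / real n"] by linarith+
    then show "real (m \<tau>) * real n \<le> \<tau>" "\<tau> \<le> real (Suc (m \<tau>)) * real n"
      using n by (auto simp: field_simps)
  qed
  have mlim: "filterlim m at_top at_top"
    unfolding filterlim_at_top
  proof
    fix Z :: nat
    show "\<forall>\<^sub>F \<tau> in at_top. Z \<le> m \<tau>"
      using eventually_ge_at_top[of "real Z * real n"]
      by eventually_elim (use n in \<open>auto simp: m_def field_simps intro!: le_nat_floor\<close>)
  qed
  have I_mono: "I x \<le> I y" if "T \<le> x" "0 \<le> x" "x \<le> y" for x y
  proof -
    have "f integrable_on {0..y}"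
      by (rule integrable_on_subinterval[OF int[of "Suc (m y)"]]) (use m[of y] that in auto)
    then have "f integrable_on {x..y}" "I x + integral {x..y} f = I y"
      using that by (auto simp: I_def intro: Henstock_Kurzweil_Integration.integral_combine integrable_on_subinterval)
    moreover have "0 \<le> integral {x..y} f"
      using calculation(1) nonneg that by (intro Henstock_Kurzweil_Integration.integral_nonneg) auto
    ultimately show ?thesis by simp
  qed
  have mn: "((\<lambda>\<tau>. real (m \<tau>) * real n / \<tau>) \<longlongrightarrow> 1) at_top"
  proof (rule tendsto_sandwich)
    show "((\<lambda>\<tau>. real (m \<tau>) / real (Suc (m \<tau>))) \<longlongrightarrow> 1) at_top"
      by (rule filterlim_compose[OF LIMSEQ_n_over_Suc_n mlim])
    show "\<forall>\<^sub>F \<tau> in at_top. real (m \<tau>) / real (Suc (m \<tau>)) \<le> real (m \<tau>) * real n / \<tau>"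
      using eventually_gt_at_top[of 0]
    proof eventually_elim
      case (elim \<tau>)
      have "real (m \<tau>) / real (Suc (m \<tau>)) = real (m \<tau>) * real n / (real (Suc (m \<tau>)) * real n)"
        using n by simp
      also have "\<dots> \<le> real (m \<tau>) * real n / \<tau>"
        using m[of \<tau>] elim n by (intro divide_left_mono) auto
      finally show ?case .
    qed
    show "\<forall>\<^sub>F \<tau> in at_top. real (m \<tau>) * real n / \<tau> \<le> 1"
      using eventually_gt_at_top[of 0] by eventually_elim (use m in auto)
  qed simp
  \<comment> \<open>The increment of \<open>I\<close> over block \<open>L\<close>, divided by
    \<open>L * n\<close>. Both terms tend to \<open>\<delta>\<close>, so one block contributes
    nothing in the limit.\<close>
  have b: "(\<lambda>L. (1 + 1 / real L) * a (Suc L) - a L) \<longlonglongrightarrow> (1 + 0) * \<delta> - \<delta>"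
    by (intro tendsto_intros lim_1_over_n a LIMSEQ_Suc[OF a])
  have d: "((\<lambda>\<tau>. (I \<tau> - I (real (m \<tau>) * real n)) / \<tau>) \<longlongrightarrow> 0) at_top"
  proof (rule tendsto_sandwich[where f="\<lambda>_. 0"])
    show "((\<lambda>\<tau>. (1 + 1 / real (m \<tau>)) * a (Suc (m \<tau>)) - a (m \<tau>)) \<longlongrightarrow> 0) at_top"
      using filterlim_compose[OF b mlim] by simp
    have ev: "\<forall>\<^sub>F \<tau> in at_top. T \<le> real (m \<tau>) * real n \<and> 0 < m \<tau> \<and> 0 < \<tau>"
    proof -
      obtain K0 :: nat where "T \<le> real K0" using real_arch_simple by blast
      then obtain K where K: "T \<le> real K" "0 < K" by (intro that[of "Suc K0"]) auto
      have "\<forall>\<^sub>F \<tau> in at_top. K \<le> m \<tau>" using mlim by (simp add: filterlim_at_top)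
      then show ?thesis using eventually_gt_at_top[of 0]
      proof eventually_elim
        case (elim \<tau>)
        have "real K * 1 \<le> real (m \<tau>) * real n" using elim n by (intro mult_mono) auto
        then show ?case using K elim by auto
      qed
    qed
    then show "\<forall>\<^sub>F \<tau> in at_top. 0 \<le> (I \<tau> - I (real (m \<tau>) * real n)) / \<tau>"
      by eventually_elim (use m I_mono in auto)
    show "\<forall>\<^sub>F \<tau> in at_top. (I \<tau> - I (real (m \<tau>) * real n)) / \<tau> \<le> (1 + 1 / real (m \<tau>)) * a (Suc (m \<tau>)) - a (m \<tau>)"
      using ev
    proof eventually_elim
      case (elim \<tau>)
      let ?x = "real (m \<tau>) * real n" and ?y = "real (Suc (m \<tau>)) * real n"
      have x: "?x \<le> \<tau>" "\<tau> \<le> ?y" using m elim by auto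
      have "I ?x \<le> I \<tau>" "I \<tau> \<le> I ?y" using I_mono x elim by auto
      then have "(I \<tau> - I ?x) / \<tau> \<le> (I ?y - I ?x) / ?x"
        using x elim n by (intro frac_le) auto
      also have "\<dots> = (1 + 1 / real (m \<tau>)) * a (Suc (m \<tau>)) - a (m \<tau>)"
      proof -
        have "1 + 1 / real (m \<tau>) = real (Suc (m \<tau>)) / real (m \<tau>)" using elim by (simp add: field_simps)
        then have "(1 + 1 / real (m \<tau>)) * a (Suc (m \<tau>)) = I ?y / ?x"
          unfolding a_def by (simp del: of_nat_Suc)
        then show ?thesis by (simp add: a_def diff_divide_distrib)
      qed
      finally show ?case .
    qed
  qed simp
  have "((\<lambda>\<tau>. a (m \<tau>) * (real (m \<tau>) * real n / \<tau>) + (I \<tau> - I (real (m \<tau>) * real n)) / \<tau>) \<longlongrightarrow> \<delta> * 1 + 0) at_top"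
    by (intro tendsto_intros d mn filterlim_compose[OF a mlim])
  moreover have "\<forall>\<^sub>F \<tau> in at_top. a (m \<tau>) * (real (m \<tau>) * real n / \<tau>) + (I \<tau> - I (real (m \<tau>) * real n)) / \<tau> = 1 / \<tau> * I \<tau>"
  proof -
    have "\<forall>\<^sub>F \<tau> in at_top. 1 \<le> m \<tau>" using mlim by (simp add: filterlim_at_top)
    then show ?thesis
      using eventually_gt_at_top[of 0]
    proof eventually_elim
      case (elim \<tau>)
      have "a (m \<tau>) * (real (m \<tau>) * real n) = I (real (m \<tau>) * real n)"
        using elim n by (simp add: a_def)
      then show ?case using elim by (simp add: field_simps)
    qed
  qed
  ultimately have "((\<lambda>\<tau>. 1 / \<tau> * I \<tau>) \<longlongrightarrow> \<delta>) at_top"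
    by (auto dest: Lim_transform_eventually)
  then show ?thesis by (simp add: I_def)
qed

lemma block_average_split:
  fixes d c s n L :: real
  assumes "0 < n" "0 < L"
  shows "d / n * (1 / L) + c / n + s / L = (d + L * c + n * s) / (L * n)"
  using assms by (simp add: field_simps)

lemma not_determined_empty: "\<not> determined (g :: nat \<Rightarrow> 'q::field ^ 'k) {}"
proof -
  have "axis undefined 1 \<noteq> (0 :: 'q ^ 'k)" by simp
  then show ?thesis unfolding determined_def by blast
qed

lemma determined_mono: "determined g J \<Longrightarrow> J \<subseteq> J' \<Longrightarrow> determined g J'"
  unfolding determined_def by blast

lemma received_mono: "i \<le> j \<Longrightarrow> received n e l i \<subseteq> received n e l j"
  by (auto simp: received_def)

text \<open>\<open>first_hit\<close> searches from 0 and \<open>decoded_at\<close> from 1; they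
  agree because nothing is determined at position 0.\<close>

lemma first_hit_eq_iff:
  assumes "\<And>i j. i \<le> j \<Longrightarrow> Q i \<Longrightarrow> Q j" "\<not> Q 0"
  shows "first_hit n Q = j \<and> j \<le> n \<longleftrightarrow> j \<in> {1..n} \<and> Q j \<and> (\<forall>i\<in>{1..<j}. \<not> Q i)"
proof -
  have le: "first_hit n Q \<le> i \<longleftrightarrow> Q i" if "i \<le> n" for i
    using first_hit_le_iff[of Q i n] assms(1) that by blast
  show ?thesis
  proof (intro iffI)
    assume h: "first_hit n Q = j \<and> j \<le> n"
    then have "Q i \<longleftrightarrow> j \<le> i" if "i \<le> n" for i using le[OF that] by auto
    then show "j \<in> {1..n} \<and> Q j \<and> (\<forall>i\<in>{1..<j}. \<not> Q i)"
      using h assms(2) by (cases j) auto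
  next
    assume h: "j \<in> {1..n} \<and> Q j \<and> (\<forall>i\<in>{1..<j}. \<not> Q i)"
    then have "first_hit n Q \<le> j" using le[of j] by auto
    moreover have "\<not> Q (j - 1)"
      using h assms(2) by (cases "j = 1") auto
    then have "\<not> first_hit n Q \<le> j - 1"
      using le[of "j - 1"] h by (metis atLeastAtMost_iff diff_le_self le_trans)
    ultimately show "first_hit n Q = j \<and> j \<le> n" using h by auto
  qed
qed

context
  fixes n :: nat and G :: "nat \<Rightarrow> nat \<Rightarrow> 'q::field ^ 'k" and e :: "nat \<Rightarrow> bool" and t0 a0 :: real
  assumes n: "0 < n"
begin

definition decode_position :: "nat \<Rightarrow> nat" where
  "decode_position l = first_hit n (\<lambda>j. determined (G (Suc l)) (received n e (Suc l) j))"

definition decoded_before :: "nat \<Rightarrow> nat set" where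
  "decoded_before l = {Suc i |i. i < l \<and> decode_position i \<le> n}"

text \<open>The amount by which decoding block \<open>l\<close> lowers the age, in the closed form that \<open>excess_eq\<close>
  justifies.  Blocks are counted from 0 here, so \<open>l\<close> stands for the block called \<open>Suc l\<close> in
  \<^const>\<open>decoded_by\<close>.\<close>

definition excess :: "nat \<Rightarrow> real" where
  "excess l = real n * real (gap n decode_position l) + (if decoded_before l = {} then 1 - frac (- t0) + a0 - real n else 0)"

lemma decoded_at_iff: "decoded_at n G e (Suc l) j \<longleftrightarrow> decode_position l = j \<and> j \<le> n"
  unfolding decoded_at_def decode_position_def
  by (rule first_hit_eq_iff[symmetric]) (auto intro: determined_mono[OF _ received_mono] simp: not_determined_empty)

lemma decode_position_pos: "0 < decode_position l"
proof -
  have "0 < decode_position l" if "decode_position l \<le> n"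
    using decoded_at_iff[of l "decode_position l"] that by (simp add: decoded_at_def)
  then show ?thesis using n by linarith
qed

lemma decoded_by_eq:
  "decoded_by n G e t = {Suc l |l. decode_position l \<le> n \<and> real l * real n + real (decode_position l) \<le> t}"
proof -
  have "l \<in> decoded_by n G e t \<longleftrightarrow> (\<exists>l'. l = Suc l' \<and> decode_position l' \<le> n \<and> real l' * real n + real (decode_position l') \<le> t)" for l
    by (cases l) (auto simp: decoded_by_def decoded_at_iff)
  then show ?thesis by blast
qed

text \<open>Earlier blocks have ended by time \<open>t\<close> and later ones have not begun, so the
  set changes at most once during a block, at its own decoding. For a lost block the minimum is
  \<open>n\<close>, which the half-open interval never reaches.\<close>

lemma decoded_by_block:
  assumes t: "real l * real n \<le> t" "t < real (Suc l) * real n"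
  shows "decoded_by n G e t =
    (if t < real l * real n + real (min (decode_position l) n) then decoded_before l else decoded_before (Suc l))"
proof -
  have early: "real i * real n + real (decode_position i) \<le> t" if "i < l" "decode_position i \<le> n" for i
  proof -
    have "i * n + decode_position i \<le> Suc i * n" using that by simp
    also have "\<dots> \<le> l * n" using that by (intro mult_le_mono1) auto
    finally have "real (i * n + decode_position i) \<le> real (l * n)" by (rule of_nat_mono)
    then show ?thesis using t by simp
  qed
  have late: "\<not> real i * real n + real (decode_position i) \<le> t" if "l < i" for i
  proof -
    have "real (Suc l) * real n \<le> real i * real n" using that by (intro mult_right_mono) auto
    then show ?thesis using t by simp
  qed
  have mem: "Suc i \<in> decoded_by n G e t \<longleftrightarrow> decode_position i \<le> n \<and> real i * real n + real (decode_position i) \<le> t" for i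
    by (auto simp: decoded_by_eq)
  have cur: "decode_position l \<le> n \<and> real l * real n + real (decode_position l) \<le> t
      \<longleftrightarrow> \<not> t < real l * real n + real (min (decode_position l) n)"
    using t by (auto simp: min_def algebra_simps)
  have "Suc i \<in> decoded_by n G e t \<longleftrightarrow>
      Suc i \<in> (if t < real l * real n + real (min (decode_position l) n) then decoded_before l else decoded_before (Suc l))" for i
    using early[of i] late[of i] cur unfolding mem
    by (cases i l rule: linorder_cases) (auto simp: decoded_before_def less_Suc_eq)
  moreover have "0 \<notin> decoded_by n G e t" "0 \<notin> decoded_before i" for i
    by (auto simp: decoded_by_eq decoded_before_def)
  ultimately show ?thesis
    by (intro set_eqI) (metis not0_implies_Suc)
qed

text \<open>The generation time of the freshest message decoded before block \<open>l\<close>. The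
  value \<open>- a0\<close> lets the initial phase have age \<open>t - last_time l\<close> as
  well.\<close>

definition last_time :: "nat \<Rightarrow> real" where
  "last_time l = (if decoded_before l = {} then - a0 else (real (Max (decoded_before l)) - 1) * real n + 1 - frac (- t0))"

text \<open>The integer part of the block start leaves the floor, and
  \<open>\<lfloor>- t0\<rfloor> + t0 = - frac (- t0)\<close>; this is the origin of the fractional
  part in the bounds.\<close>

lemma age_eq:
  "age t0 a0 n G e t = (if decoded_by n G e t = {} then a0 + t
    else t - ((real (Max (decoded_by n G e t)) - 1) * real n + 1 - frac (- t0)))"
proof -
  have "real_of_int (msg_index t0 n l) + t0 = (real l - 1) * real n + 1 - frac (- t0)" for l
  proof -
    have "(real l - 1) * real n + 1 - t0 = of_int ((int l - 1) * int n + 1) + - t0" by simp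
    then have "msg_index t0 n l = (int l - 1) * int n + 1 + \<lfloor>- t0\<rfloor>"
      unfolding msg_index_def by (simp only: floor_add_int[symmetric] add.commute)
    then show ?thesis by (simp add: frac_def)
  qed
  then show ?thesis by (simp add: age_def)
qed

lemma decoded_before_Suc:
  "decoded_before (Suc l) = (if decode_position l \<le> n then insert (Suc l) (decoded_before l) else decoded_before l)"
  by (auto simp: decoded_before_def less_Suc_eq)

lemma last_time_Suc:
  "last_time (Suc l) = (if decode_position l \<le> n then real l * real n + 1 - frac (- t0) else last_time l)"
proof -
  have "Max (insert (Suc l) (decoded_before l)) = Suc l"
    by (rule Max_eqI) (auto simp: decoded_before_def)
  then show ?thesis by (simp add: last_time_def decoded_before_Suc)
qed

text \<open>\<open>excess l\<close> is the generation time of the current message minus that of the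
  freshest one decoded before: it grows by \<open>n\<close> with every lost block. Before the first
  decoding, \<open>gap\<close> pretends that a message was generated at
  \<open>1 - frac (- t0) - n\<close>; the second summand of \<open>excess\<close> replaces that time
  by \<open>- a0\<close>.\<close>

lemma excess_eq: "excess l = real l * real n + 1 - frac (- t0) - last_time l"
proof (induction l)
  case 0
  have "decoded_before 0 = {}" by (simp add: decoded_before_def)
  then show ?case by (simp add: excess_def last_time_def)
next
  case (Suc l)
  then show ?case
    by (cases "decode_position l \<le> n"; cases "decoded_before l = {}")
      (simp_all add: excess_def last_time_Suc decoded_before_Suc algebra_simps)
qed

text \<open>Were the current message known from the start of the block, the age would integrate to
  the first two terms. Until it is decoded, the true age is larger by \<open>excess l\<close>. The
  single point at the end of each piece is dropped as a null set.\<close>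

lemma age_has_integral_block:
  "(age t0 a0 n G e has_integral
     (real n)\<^sup>2 / 2 - (1 - frac (- t0)) * real n + excess l * real (min (decode_position l) n))
   {real l * real n..real (Suc l) * real n}"
proof -
  let ?a = "real l * real n" and ?b = "real (Suc l) * real n"
  define M where "M = real (min (decode_position l) n)"
  have M: "0 \<le> M" "M \<le> real n" by (auto simp: M_def)
  have b: "?b = ?a + real n" by (simp add: algebra_simps)
  have lin: "((\<lambda>t. t - w) has_integral (d\<^sup>2 - c\<^sup>2) / 2 - w * (d - c)) {c..d}" if "c \<le> d" for c d w :: real
    using has_integral_diff[OF ident_has_integral[OF that] has_integral_const_real[of w c d]] that
    by (simp add: mult.commute)
  have age1: "age t0 a0 n G e t = t - last_time l" if "?a \<le> t" "t < ?a + M" for t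
  proof -
    have "decoded_by n G e t = decoded_before l"
      using decoded_by_block[of l t] that M b by (simp add: M_def)
    then show ?thesis by (simp add: age_eq last_time_def)
  qed
  have age2: "age t0 a0 n G e t = t - (?a + 1 - frac (- t0))" if "?a + M \<le> t" "t < ?b" for t
  proof -
    have "decode_position l \<le> n" using that b M by (auto simp: M_def min_def split: if_splits)
    moreover have "decoded_by n G e t = decoded_before (Suc l)"
      using decoded_by_block[of l t] that M by (simp add: M_def)
    then have "age t0 a0 n G e t = t - last_time (Suc l)" by (simp add: age_eq last_time_def)
    ultimately show ?thesis by (simp add: last_time_Suc)
  qed
  have 1: "(age t0 a0 n G e has_integral ((?a + M)\<^sup>2 - ?a\<^sup>2) / 2 - last_time l * (?a + M - ?a)) {?a..?a + M}"
    by (rule has_integral_spike_finite[OF _ _ lin, of "{?a + M}"]) (use age1 M in auto)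
  have 2: "(age t0 a0 n G e has_integral (?b\<^sup>2 - (?a + M)\<^sup>2) / 2 - (?a + 1 - frac (- t0)) * (?b - (?a + M))) {?a + M..?b}"
    by (rule has_integral_spike_finite[OF _ _ lin, of "{?b}"]) (use age2 M b in auto)
  have "(age t0 a0 n G e has_integral ((?a + M)\<^sup>2 - ?a\<^sup>2) / 2 - last_time l * (?a + M - ?a)
      + ((?b\<^sup>2 - (?a + M)\<^sup>2) / 2 - (?a + 1 - frac (- t0)) * (?b - (?a + M)))) {?a..?b}"
    by (rule has_integral_combine[OF _ _ 1 2]) (use M b in auto)
  moreover have "((?a + M)\<^sup>2 - ?a\<^sup>2) / 2 - last_time l * (?a + M - ?a)
      + ((?b\<^sup>2 - (?a + M)\<^sup>2) / 2 - (?a + 1 - frac (- t0)) * (?b - (?a + M)))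
      = (real n)\<^sup>2 / 2 - (1 - frac (- t0)) * real n + excess l * M"
    unfolding b excess_eq by (simp add: power2_eq_square field_simps)
  ultimately show ?thesis by (simp add: M_def)
qed

lemma age_has_integral:
  "(age t0 a0 n G e has_integral
     (\<Sum>l<L. (real n)\<^sup>2 / 2 - (1 - frac (- t0)) * real n + excess l * real (min (decode_position l) n)))
   {0..real L * real n}"
proof (induction L)
  case 0 then show ?case by (simp add: has_integral_refl)
next
  case (Suc L)
  show ?case unfolding sum.lessThan_Suc
    by (rule has_integral_combine[OF _ _ Suc age_has_integral_block]) (auto intro!: mult_right_mono)
qed

text \<open>After some decoding \<open>a0\<close> no longer enters, and a message is generated no
  later than the first channel use of its block, hence not after it is decoded.\<close>

lemma age_nonneg:
  assumes "decode_position l \<le> n" "real (Suc l) * real n \<le> t"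
  shows "0 \<le> age t0 a0 n G e t"
proof -
  let ?D = "decoded_by n G e t"
  have "real (decode_position l) \<le> real n" using assms(1) by simp
  then have ne: "?D \<noteq> {}" using assms by (auto simp: decoded_by_eq algebra_simps intro!: exI[of _ l])
  have fin: "finite ?D"
  proof (rule finite_subset)
    show "?D \<subseteq> Suc ` {..nat \<lceil>t\<rceil>}"
    proof
      fix x assume "x \<in> ?D"
      then obtain i where i: "x = Suc i" "real i * real n + real (decode_position i) \<le> t" by (auto simp: decoded_by_eq)
      have "real i * 1 \<le> real i * real n" using n by (intro mult_left_mono) auto
      then have "real i \<le> t" using i by linarith
      then show "x \<in> Suc ` {..nat \<lceil>t\<rceil>}" using i by (auto intro!: imageI) linarith
    qed
  qed auto
  obtain i where i: "Max ?D = Suc i" "real i * real n + real (decode_position i) \<le> t"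
    using Max_in[OF fin ne] by (auto simp: decoded_by_eq)
  have "1 \<le> real (decode_position i)" using decode_position_pos[of i] by linarith
  then have "real i * real n + 1 - frac (- t0) \<le> t"
    using i frac_ge_0[of "- t0"] by linarith
  then show ?thesis using ne i by (simp add: age_eq)
qed

lemma decoded_before_mono: "decode_position i \<le> n \<Longrightarrow> i < l \<Longrightarrow> decoded_before l \<noteq> {}"
  by (auto simp: decoded_before_def)

lemma gap_no_decoding: "decoded_before l = {} \<Longrightarrow> gap n decode_position l = Suc l"
  by (induction l) (auto simp: decoded_before_Suc split: if_splits)

text \<open>After the first decoded block, \<open>excess l\<close> equals \<open>n * gap\<close>.
  The earlier blocks, and \<open>a0\<close> with them, contribute a constant that the averaging
  removes.\<close>

lemma has_average_ageI:
  assumes sub: "(\<lambda>L. real (gap n decode_position L) / real L) \<longlonglongrightarrow> 0"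
    and avg: "(\<lambda>L. (\<Sum>l<L. real (gap n decode_position l) * real (min (decode_position l) n)) / real L) \<longlonglongrightarrow> x"
  shows "has_average_age t0 a0 n G e (real n / 2 - 1 + frac (- t0) + x)"
proof -
  \<comment> \<open>Without any decoded block the gap at \<open>L\<close> would be
    \<open>Suc L\<close>, which is not sublinear.\<close>
  have "\<exists>l. decode_position l \<le> n"
  proof (rule ccontr)
    assume "\<nexists>l. decode_position l \<le> n"
    then have g: "gap n decode_position L = Suc L" for L
      by (intro gap_no_decoding) (auto simp: decoded_before_def)
    have "\<forall>\<^sub>F L in sequentially. 1 \<le> real (gap n decode_position L) / real L"
      using eventually_gt_at_top[of 0] by eventually_elim (simp add: g field_simps)
    then have "(1 :: real) \<le> 0" by (rule tendsto_lowerbound[OF sub]) simp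
    then show False by simp
  qed
  then obtain l0 where l0: "decode_position l0 \<le> n" by blast
  let ?g = "\<lambda>l. real (gap n decode_position l) * real (min (decode_position l) n)"
  let ?c = "(real n)\<^sup>2 / 2 - (1 - frac (- t0)) * real n"
  let ?h = "\<lambda>l. ?c + excess l * real (min (decode_position l) n)"
  define d where "d = (\<Sum>l<Suc l0. ?h l - (?c + real n * ?g l))"
  have tail: "?h l = ?c + real n * ?g l" if "l0 < l" for l
    using decoded_before_mono[OF l0 that] by (simp add: excess_def)
  have sum: "(\<Sum>l<L. ?h l) = d + (\<Sum>l<L. ?c + real n * ?g l)" if "l0 < L" for L
  proof -
    have "(\<Sum>l<L. ?h l - (?c + real n * ?g l)) = d"
      unfolding d_def using that tail by (intro sum.mono_neutral_right) auto
    then show ?thesis by (simp only: sum_subtractf)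
  qed
  have "(\<lambda>L. d / real n * (1 / real L) + ?c / real n + (\<Sum>l<L. ?g l) / real L) \<longlonglongrightarrow> d / real n * 0 + ?c / real n + x"
    by (intro tendsto_intros avg lim_1_over_n)
  moreover have "\<forall>\<^sub>F L in sequentially. d / real n * (1 / real L) + ?c / real n + (\<Sum>l<L. ?g l) / real L
      = integral {0..real L * real n} (age t0 a0 n G e) / (real L * real n)"
    using eventually_gt_at_top[of l0]
  proof eventually_elim
    case (elim L)
    have "integral {0..real L * real n} (age t0 a0 n G e) = d + real L * ?c + real n * (\<Sum>l<L. ?g l)"
      using integral_unique[OF age_has_integral[of L]] sum[OF elim] by (simp add: sum.distrib sum_distrib_left)
    then show ?case using n elim by (simp only: block_average_split of_nat_0_less_iff)
  qed
  ultimately have "(\<lambda>L. integral {0..real L * real n} (age t0 a0 n G e) / (real L * real n)) \<longlonglongrightarrow> ?c / real n + x"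
    by (auto dest: Lim_transform_eventually)
  moreover have "?c / real n + x = real n / 2 - 1 + frac (- t0) + x"
    using n by (simp add: field_simps power2_eq_square)
  ultimately show ?thesis
    unfolding has_average_age_def
    by (intro average_of_block_averages[OF n has_integral_integrable[OF age_has_integral] age_nonneg[OF l0]]) auto
qed

text \<open>Later decoding enlarges both the gap and the capped position, so from some block on the
  integrals dominate those belonging to \<open>N\<close>. The limit exists by assumption, hence may
  be taken along the ends of blocks.\<close>

lemma average_age_ge:
  assumes age: "has_average_age t0 a0 n G e \<delta>"
    and N: "\<And>l. N l \<le> decode_position l"
    and sub: "(\<lambda>L. real (gap n N L) / real L) \<longlonglongrightarrow> 0"
    and avg: "(\<lambda>L. (\<Sum>l<L. real (gap n N l) * real (min (N l) n)) / real L) \<longlonglongrightarrow> x"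
  shows "real n / 2 - 1 + frac (- t0) + x \<le> \<delta>"
proof -
  let ?c = "(real n)\<^sup>2 / 2 - (1 - frac (- t0)) * real n"
  let ?h = "\<lambda>l. ?c + excess l * real (min (decode_position l) n)"
  let ?g = "\<lambda>l. ?c + real n * (real (gap n N l) * real (min (N l) n))"
  have gap_le: "gap n N l \<le> gap n decode_position l" for l
    by (induction l) (use N in \<open>auto intro: order_trans\<close>)
  have "\<exists>l0. \<forall>l\<ge>l0. real n * real (gap n N l) \<le> excess l"
  proof (cases "\<exists>i. decode_position i \<le> n")
    case True
    then obtain i where i: "decode_position i \<le> n" by blast
    have "real n * real (gap n N l) \<le> excess l" if "Suc i \<le> l" for l
      using decoded_before_mono[OF i, of l] that gap_le[of l] by (simp add: excess_def mult_left_mono)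
    then show ?thesis by blast
  next
    case False
    then have none: "decoded_before l = {}" for l by (auto simp: decoded_before_def)
    \<comment> \<open>If nothing is ever decoded, \<open>excess l\<close> is \<open>l * n\<close>
      plus a constant depending on \<open>a0\<close>. Sublinearity gives
      \<open>gap n N l < l / 2\<close> eventually, and past \<open>K\<close> the remaining
      \<open>l * n / 2\<close> absorbs the constant even if it is negative.\<close>
    obtain K :: nat where K: "- 2 * (1 - frac (- t0) + a0) \<le> real K" using real_arch_simple by blast
    have "\<forall>\<^sub>F l in sequentially. real (gap n N l) / real l < 1 / 2"
      by (rule order_tendstoD[OF sub]) simp
    then have "\<forall>\<^sub>F l in sequentially. real n * real (gap n N l) \<le> excess l"
      using eventually_gt_at_top[of K]
    proof eventually_elim
      case (elim l)
      have "real l * 1 \<le> real l * real n" using n by (intro mult_left_mono) auto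
      then have "- 2 * (1 - frac (- t0) + a0) \<le> real l * real n" using elim K by linarith
      moreover have "real n * real (gap n N l) \<le> real n * (real l / 2)"
        using elim by (intro mult_left_mono) (auto simp: field_simps)
      moreover have "excess l = real l * real n + (1 - frac (- t0) + a0)"
        using gap_no_decoding[OF none[of l]] by (simp add: excess_def none algebra_simps)
      ultimately show ?case by (simp add: field_simps)
    qed
    then show ?thesis by (simp add: eventually_sequentially)
  qed
  then obtain l0 where l0: "\<And>l. l0 \<le> l \<Longrightarrow> real n * real (gap n N l) \<le> excess l" by blast
  have tail: "?g l \<le> ?h l" if "l0 \<le> l" for l
  proof -
    have "real n * real (gap n N l) * real (min (N l) n) \<le> excess l * real (min (decode_position l) n)"
      using l0[OF that] N[of l] by (intro mult_mono order_trans[OF _ l0[OF that]]) auto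
    then show ?thesis by (simp add: mult.assoc)
  qed
  define d where "d = (\<Sum>l<l0. ?h l - ?g l)"
  have sum: "d + (\<Sum>l<L. ?g l) \<le> (\<Sum>l<L. ?h l)" if "l0 \<le> L" for L
  proof -
    have "(\<Sum>l<l0. ?h l - ?g l) \<le> (\<Sum>l<L. ?h l - ?g l)"
      using that tail by (intro sum_mono2) auto
    then show ?thesis by (simp only: d_def sum_subtractf)
  qed
  have lim1: "(\<lambda>L. d / real n * (1 / real L) + ?c / real n + (\<Sum>l<L. real (gap n N l) * real (min (N l) n)) / real L)
      \<longlonglongrightarrow> d / real n * 0 + ?c / real n + x"
    by (intro tendsto_intros avg lim_1_over_n)
  have lim2: "(\<lambda>L. 1 / (real L * real n) * integral {0..real L * real n} (age t0 a0 n G e)) \<longlonglongrightarrow> \<delta>"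
  proof -
    have "filterlim (\<lambda>L. real n * real L) at_top sequentially"
      using n by (intro filterlim_tendsto_pos_mult_at_top[OF tendsto_const _ filterlim_real_sequentially]) auto
    then have "filterlim (\<lambda>L. real L * real n) at_top sequentially" by (simp add: mult.commute)
    from filterlim_compose[OF age[unfolded has_average_age_def] this] show ?thesis .
  qed
  have "d / real n * 0 + ?c / real n + x \<le> \<delta>"
  proof (rule tendsto_le[OF _ lim2 lim1])
    show "\<forall>\<^sub>F L in sequentially. d / real n * (1 / real L) + ?c / real n + (\<Sum>l<L. real (gap n N l) * real (min (N l) n)) / real L
        \<le> 1 / (real L * real n) * integral {0..real L * real n} (age t0 a0 n G e)"
      using eventually_gt_at_top[of l0]
    proof eventually_elim
      case (elim L)
      have "d + (\<Sum>l<L. ?g l) \<le> integral {0..real L * real n} (age t0 a0 n G e)"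
        using integral_unique[OF age_has_integral[of L]] sum[of L] elim by simp
      then have "(d + (\<Sum>l<L. ?g l)) / (real L * real n) \<le> integral {0..real L * real n} (age t0 a0 n G e) / (real L * real n)"
        by (rule divide_right_mono) simp
      moreover have "(d + (\<Sum>l<L. ?g l)) / (real L * real n)
          = d / real n * (1 / real L) + ?c / real n + (\<Sum>l<L. real (gap n N l) * real (min (N l) n)) / real L"
        using n elim block_average_split[of "real n" "real L" d ?c]
        by (simp add: sum.distrib sum_distrib_left[symmetric] add.assoc)
      ultimately show ?case by simp
    qed
  qed simp
  moreover have "?c / real n + x = real n / 2 - 1 + frac (- t0) + x"
    using n by (simp add: field_simps power2_eq_square)
  ultimately show ?thesis by simp
qed

end


section \<open>Optimality\<close>

lemma first_hit_antimono:
  assumes "\<And>j. Q j \<Longrightarrow> Q' j"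
  shows "first_hit n Q' \<le> first_hit n Q"
proof (cases "\<exists>j\<le>n. Q j")
  case True
  then have "Q (LEAST j. Q j)" by (auto intro: LeastI)
  then show ?thesis using True assms by (auto simp: first_hit_def intro!: Least_le)
next
  case False
  then have "first_hit n Q = Suc n" unfolding first_hit_def by (rule if_not_P)
  moreover have "(LEAST j. Q' j) \<le> Suc n" if "\<exists>j\<le>n. Q' j"
    using that by (auto intro: Least_le order_trans)
  then have "first_hit n Q' \<le> Suc n" by (metis first_hit_def order_refl)
  ultimately show ?thesis by simp
qed

lemma determined_card_le:
  fixes g :: "nat \<Rightarrow> 'q::field ^ 'k::finite"
  assumes "determined g J" "finite J"
  shows "CARD('k) \<le> card J"
proof -
  have "vec.dim (vec.span (g ` J)) = CARD('k)"
    using assms(1) by (simp only: determined_iff_span vec_dim_card)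
  then show ?thesis
    using vec.dim_le_card'[of "g ` J"] card_image_le[of J g] assms by simp
qed

text \<open>At least \<open>k\<close> symbols are needed to determine a message, so for every
  erasure pattern the ideal decoder is never later. The conclusion does not mention the pattern, so
  holding almost surely means holding.\<close>

lemma age_lb_le_average_age:
  fixes G :: "nat \<Rightarrow> nat \<Rightarrow> 'q::{field,finite} ^ 'k::finite"
  assumes \<epsilon>: "0 \<le> \<epsilon>" "\<epsilon> < 1" and n: "CARD('k) \<le> n"
    and age: "AE e in erasure_space \<epsilon>. has_average_age t0 a0 n G e \<delta>"
  shows "age_lb \<epsilon> (CARD('k)) t0 n \<le> \<delta>"
proof -
  interpret prob_space "erasure_space \<epsilon>" by (rule prob_space_erasure_space)
  have k: "0 < CARD('k)" by simp
  with n have n0: "0 < n" by linarith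
  have "AE e in erasure_space \<epsilon>. age_lb \<epsilon> (CARD('k)) t0 n \<le> \<delta>"
    using age ideal_gap_sublinear[OF \<epsilon> n] ideal_gap_average[OF \<epsilon> n]
  proof eventually_elim
    case (elim e)
    have le: "first_hit n (\<lambda>j. CARD('k) \<le> card (received n e (Suc l) j)) \<le> decode_position n G e l" for l
      unfolding decode_position_def[OF n0]
      by (intro first_hit_antimono determined_card_le) auto
    show ?case
      using average_age_ge[OF n0 elim(1) le elim(2,3)] \<epsilon>
      by (simp add: age_lb_def age_bound_eq[OF _ _ k n])
  qed
  then show ?thesis by simp
qed

text \<open>Linear growth in \<open>n\<close> confines the search for a minimum to finitely many
  blocklengths.\<close>

lemma age_lb_ge:
  assumes "0 \<le> \<epsilon>" "\<epsilon> < 1" "0 < k" "k \<le> n"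
  shows "real n / 2 - 1 \<le> age_lb \<epsilon> k t0 n"
proof -
  have "0 < (1 - \<epsilon>) ^ k" using assms by simp
  also have "\<dots> \<le> hit (\<lambda>_. 1 - \<epsilon>) n k" using assms by (intro hit_ge_power) auto
  finally have "0 \<le> (\<Sum>j<n. 1 - hit (\<lambda>_. 1 - \<epsilon>) j k) / hit (\<lambda>_. 1 - \<epsilon>) n k"
    using assms by (intro divide_nonneg_pos sum_nonneg) (auto intro: hit_le_1)
  then show ?thesis
    using assms frac_ge_0[of "- t0"] unfolding age_lb_def by (subst age_bound_eq) linarith+
qed

lemma ex_arg_min_age_lb:
  assumes "0 \<le> \<epsilon>" "\<epsilon> < 1" "0 < k"
  shows "\<exists>n. is_arg_min (age_lb \<epsilon> k t0) (\<lambda>m. k \<le> m) n"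
proof -
  let ?f = "age_lb \<epsilon> k t0"
  \<comment> \<open>From \<open>K\<close> on, the linear lower bound is at least the value at
    \<open>k\<close>, so nothing beyond \<open>S\<close> can be smaller.\<close>
  obtain K :: nat where K: "2 * (?f k + 1) \<le> real K" using real_arch_simple by blast
  define S where "S = {k..max k K}"
  have "finite S" "S \<noteq> {}" by (auto simp: S_def)
  then obtain n where n: "is_arg_min ?f (\<lambda>m. m \<in> S) n" using ex_is_arg_min_if_finite[of S ?f] by blast
  have "?f n \<le> ?f m" if "k \<le> m" for m
  proof (cases "m \<in> S")
    case True then show ?thesis using n by (auto simp: is_arg_min_linorder)
  next
    case False
    then have "real K \<le> real m" using that by (auto simp: S_def)
    with K have "2 * (?f k + 1) \<le> real m" by (rule order_trans)
    then have "?f k \<le> real m / 2 - 1" by (simp add: field_simps)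
    also have "\<dots> \<le> ?f m" using assms that by (intro age_lb_ge) auto
    finally show ?thesis using n by (auto simp: is_arg_min_linorder S_def intro: order_trans)
  qed
  then show ?thesis using n by (auto simp: is_arg_min_linorder S_def intro!: exI[of _ n])
qed

text \<open>Fubini in the order that fixes the columns first and then lets the erasures vary, as in
  the definition of \<open>optimal_linear_age\<close>.\<close>

lemma AE_pair_swap:
  assumes "prob_space M" "prob_space N" "AE (x, y) in M \<Otimes>\<^sub>M N. P x y"
  shows "AE y in N. AE x in M. P x y"
proof -
  interpret M: prob_space M by fact
  interpret N: prob_space N by fact
  interpret MN: pair_prob_space M N ..
  interpret NM: pair_prob_space N M ..
  have "AE z in distr (N \<Otimes>\<^sub>M M) (M \<Otimes>\<^sub>M N) (\<lambda>(x, y). (y, x)). case z of (x, y) \<Rightarrow> P x y"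
    by (subst MN.distr_pair_swap[symmetric]) (rule assms(3))
  then have "AE z in N \<Otimes>\<^sub>M M. case (case z of (x, y) \<Rightarrow> (y, x)) of (x, y) \<Rightarrow> P x y"
    by (rule AE_distrD[rotated]) (rule measurable_pair_swap')
  then show ?thesis
    using NM.AE_pair by fastforce
qed

theorem mainTheorem6:
  fixes \<epsilon> t0 a0 :: real and q k n :: nat
  assumes "q = CARD('q::{field,finite})" and "k = CARD('k::finite)"
    and "0 \<le> \<epsilon>" and "\<epsilon> < 1" and "2 \<le> k" and "k \<le> n"
  shows "(AE (e, g) in erasure_space \<epsilon> \<Otimes>\<^sub>M
             (column_space :: (nat \<times> nat \<Rightarrow> 'q ^ 'k) measure).
            \<exists>\<delta>. has_average_age t0 a0 n (\<lambda>l j. g (l, j)) e \<delta> \<and>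
                age_lb \<epsilon> k t0 n \<le> \<delta> \<and> \<delta> \<le> age_ub q \<epsilon> k t0 n \<and>
                optimal_linear_age TYPE('q ^ 'k) \<epsilon> t0 a0 \<le> ereal \<delta>) \<and>
         (\<exists>n'. is_arg_min (age_lb \<epsilon> k t0) (\<lambda>m. k \<le> m) n' \<and>
               ereal (age_lb \<epsilon> k t0 n') \<le> optimal_linear_age TYPE('q ^ 'k) \<epsilon> t0 a0)"
proof (intro conjI)
  note \<epsilon> = \<open>0 \<le> \<epsilon>\<close> \<open>\<epsilon> < 1\<close>
  note k = \<open>k = CARD('k)\<close>
  have k0: "0 < k" and n0: "0 < n" using assms by auto
  have q2: "2 \<le> q"
  proof -
    have "card {0, 1 :: 'q} \<le> CARD('q)" by (intro card_mono) auto
    then show ?thesis by (simp add: assms(1))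
  qed
  let ?C = "column_space :: (nat \<times> nat \<Rightarrow> 'q ^ 'k) measure"
  interpret C: prob_space ?C by (rule prob_space_column_space)
  define h where "h j = hit (innovation q \<epsilon> k) j k" for j
  \<comment> \<open>This value depends neither on the erasures nor on the columns, so all remaining
    inequalities concern a single number.\<close>
  define \<delta> where "\<delta> = real n / 2 - 1 + frac (- t0) + (\<Sum>j<n. 1 - h j) / h n"
  note random = random_gap_sublinear[OF \<epsilon> k \<open>k \<le> n\<close> assms(1)] random_gap_average[OF \<epsilon> k \<open>k \<le> n\<close> assms(1)]
  have age: "AE (e, g) in erasure_space \<epsilon> \<Otimes>\<^sub>M ?C. has_average_age t0 a0 n (\<lambda>l j. g (l, j)) e \<delta>"
    using random
  proof eventually_elim
    case (elim x)
    let ?G = "\<lambda>l j. snd x (l, j)"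
    have N: "decode_position n ?G (fst x) =
        (\<lambda>l. first_hit n (\<lambda>j. determined (\<lambda>i. snd x (Suc l, i)) (received n (fst x) (Suc l) j)))"
      by (simp add: decode_position_def[OF n0] fun_eq_iff)
    have "has_average_age t0 a0 n ?G (fst x) \<delta>"
      unfolding \<delta>_def h_def
      by (rule has_average_ageI[OF n0]) (use elim in \<open>simp_all add: N split_beta\<close>)
    then show ?case by (simp add: split_beta)
  qed
  have "AE g in ?C. AE e in erasure_space \<epsilon>. has_average_age t0 a0 n (\<lambda>l j. g (l, j)) e \<delta>"
    by (rule AE_pair_swap[OF prob_space_erasure_space prob_space_column_space age])
  \<comment> \<open>One good choice of columns is a deterministic linear scheme of average age
    \<open>\<delta>\<close>. It gives the lower bound on \<open>\<delta>\<close> and, as a member of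
    the set under the infimum, the comparison with the optimum.\<close>
  then obtain g :: "nat \<times> nat \<Rightarrow> 'q ^ 'k"
    where g: "AE e in erasure_space \<epsilon>. has_average_age t0 a0 n (\<lambda>l j. g (l, j)) e \<delta>"
    using eventually_happens'[OF C.ae_filter_bot] by blast
  have lb: "age_lb \<epsilon> k t0 n \<le> \<delta>"
    using age_lb_le_average_age[OF \<epsilon> _ g] \<open>k \<le> n\<close> k by simp
  have opt: "optimal_linear_age TYPE('q ^ 'k) \<epsilon> t0 a0 \<le> ereal \<delta>"
    unfolding optimal_linear_age_def using g \<open>k \<le> n\<close> k by (intro Inf_lower) blast
  have ub: "\<delta> \<le> age_ub q \<epsilon> k t0 n"
  proof -
    let ?p = "innovation_prob q \<epsilon> k"
    have p: "0 < ?p" "?p \<le> 1"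
      using innovation_prob_pos[OF \<epsilon> q2 k0] innovation_prob_le_1[OF \<epsilon> q2 k0] by auto
    have ge: "hit (\<lambda>_. ?p) j k \<le> h j" for j
      unfolding h_def by (rule random_hit_ge[OF \<epsilon> k \<open>k \<le> n\<close> assms(1)])
    have "0 < ?p ^ k" using p by simp
    also have "\<dots> \<le> hit (\<lambda>_. ?p) n k" using p \<open>k \<le> n\<close> by (intro hit_ge_power) auto
    finally have pos: "0 < hit (\<lambda>_. ?p) n k" .
    \<comment> \<open>Larger decoding probabilities lower the numerator and raise the
      denominator.\<close>
    have "(\<Sum>j<n. 1 - h j) / h n \<le> (\<Sum>j<n. 1 - hit (\<lambda>_. ?p) j k) / hit (\<lambda>_. ?p) n k"
      using ge pos p by (intro frac_le sum_nonneg sum_mono) (auto intro: hit_le_1)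
    then show ?thesis
      unfolding \<delta>_def age_ub_def age_bound_eq[OF p k0 \<open>k \<le> n\<close>] by simp
  qed
  show "AE (e, g) in erasure_space \<epsilon> \<Otimes>\<^sub>M ?C.
      \<exists>\<delta>. has_average_age t0 a0 n (\<lambda>l j. g (l, j)) e \<delta> \<and>
          age_lb \<epsilon> k t0 n \<le> \<delta> \<and> \<delta> \<le> age_ub q \<epsilon> k t0 n \<and>
          optimal_linear_age TYPE('q ^ 'k) \<epsilon> t0 a0 \<le> ereal \<delta>"
    using age by eventually_elim (use lb ub opt in auto)
  obtain n' where n': "is_arg_min (age_lb \<epsilon> k t0) (\<lambda>m. k \<le> m) n'"
    using ex_arg_min_age_lb[OF \<epsilon> k0] by blast
  have "ereal (age_lb \<epsilon> k t0 n') \<le> optimal_linear_age TYPE('q ^ 'k) \<epsilon> t0 a0"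
    unfolding optimal_linear_age_def
  proof (rule Inf_greatest, clarify)
    fix \<delta> m and G :: "nat \<Rightarrow> nat \<Rightarrow> 'q ^ 'k"
    assume m: "CARD('k) \<le> m" and G: "AE e in erasure_space \<epsilon>. has_average_age t0 a0 m G e \<delta>"
    have "age_lb \<epsilon> k t0 n' \<le> age_lb \<epsilon> k t0 m"
      using n' m by (simp add: is_arg_min_linorder k)
    also have "\<dots> \<le> \<delta>"
      using age_lb_le_average_age[OF \<epsilon> m G] by (simp add: k)
    finally show "ereal (age_lb \<epsilon> k t0 n') \<le> ereal \<delta>" by simp
  qed
  with n' show "\<exists>n'. is_arg_min (age_lb \<epsilon> k t0) (\<lambda>m. k \<le> m) n' \<and>
      ereal (age_lb \<epsilon> k t0 n') \<le> optimal_linear_age TYPE('q ^ 'k) \<epsilon> t0 a0" by blast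
qed

end
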